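(* Let $A$ be a finite set of natural numbers which is a subset of a bi-arithmetic progression $I\cup J$ such that $|A|=k>10$ and both $A\cap I$ and $A\cap J$ are non-empty. If $|2A|=3k-3+b$ with $0\leqslant b<\frac13k-2$, then $I$ and $J$ can be chosen so that $|I|+|J|\leqslant k+b$; that is, there is a bi-arithmetic progression $I'\cup J'$ with $A\subseteq I'\cup J'$, $A\cap I'\neq\emptyset$, $A\cap J'\neq\emptyset$, and $|I'|+|J'|\leqslant k+b$.
   Context: $2A=A+A=\{a+a':a,a'\in A\}$. For non-negative integers $a,d,k$ with $d,k\geqslant 1$, the set $\{a,a+d,\ldots,a+(k-1)d\}$ is an arithmetic progression of length $k$ with difference $d$. A bi-arithmetic progression of length $k$ with difference $d$ is a set of the form $I\cup J$ where $I$ and $J$ are arithmetic progressions of difference $d$, $|I|+|J|=k$, and $I+I$, $I+J$, $J+J$ are pairwise disjoint. *)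

theory Defs
  imports Complex_Main "HOL-Library.Set_Algebras"
begin

text \<open>Sumsets are those of \<^theory>\<open>HOL-Library.Set_Algebras\<close>: \<open>A + B\<close> is the set of all
  \<open>a + b\<close> with \<open>a \<in> A\<close> and \<open>b \<in> B\<close>; in particular \<open>2A\<close> is \<open>A + A\<close>.\<close>

text \<open>A singleton is an arithmetic progression of length 1 for every difference \<open>d \<ge> 1\<close>.\<close>

definition arith_prog :: "nat \<Rightarrow> nat \<Rightarrow> nat set \<Rightarrow> bool" where
  "arith_prog d k P \<longleftrightarrow> d \<ge> 1 \<and> k \<ge> 1 \<and> (\<exists>a. P = {a + i * d | i. i < k})"

text \<open>The predicate takes the two parts \<open>I\<close> and \<open>J\<close> rather than the set \<open>I \<union> J\<close>, because
  \<open>I \<union> J\<close> alone does not determine the decomposition.\<close>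

definition bi_arith_prog :: "nat \<Rightarrow> nat \<Rightarrow> nat set \<Rightarrow> nat set \<Rightarrow> bool" where
  "bi_arith_prog d k I J \<longleftrightarrow>
     (\<exists>m. arith_prog d m I) \<and> (\<exists>n. arith_prog d n J) \<and> card I + card J = k \<and>
     (I + I) \<inter> (I + J) = {} \<and> (I + I) \<inter> (J + J) = {} \<and> (I + J) \<inter> (J + J) = {}"

end

(* Write A1, A2 for the two parts of A, with |A1| >= |A2|, and measure the excess of |2A1|, |A1+A2|,
   |2A2| over the trivial bounds 2|A1|-1, |A1|+|A2|-1, 2|A2|-1; the three excesses add up to b.
   Since b is small, Freiman's 3k-4 theorem applies to A1: the holes of A1 in its hull, an arithmetic
   progression with difference g, are at most the excess of |2A1|, and A2 lies in one class modulo g,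
   for otherwise A1+A2 would be too large. If |A2| >= k/3, the same works for A2. Otherwise rescale
   to g = 1 and let A1, A2 have hulls [0,N] and [0,m]. If A1+A2 meets every class modulo m, its excess
   is at least the number of holes of A2. A class modulo m that A1+A2 misses consists of holes of A1;
   either it contains a hole x with both x and x+N in 2A1, which adds one to the excess of |2A1|, or
   A1 is so thin that the excesses add up to more than b.
   The 3k-4 theorem is obtained from a weak form of Kneser's theorem in the integers modulo N, where
   subsets of the cyclic group are represented as N-periodic sets of integers. *)

theory Submission
  imports Defs
begin

section \<open>Sumsets of integers\<close>

lemma card_translate [simp]: "card ((\<lambda>x. x + t) ` A) = card A" for t :: "'a :: cancel_semigroup_add"
  by (rule card_image) (auto simp: inj_on_def)

lemma sumsetI: "a \<in> A \<Longrightarrow> b \<in> B \<Longrightarrow> x = a + b \<Longrightarrow> x \<in> A + B" for A B :: "'a :: plus set"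
  by (simp add: set_plus_intro)

text \<open>The translates of \<open>A\<close> by \<open>Max B\<close> and of \<open>B\<close> by
  \<open>Min A\<close> lie in \<open>A + B\<close> and share only
  \<open>Min A + Max B\<close>.\<close>

lemma card_sumset_ge:
  fixes A B :: "'a :: linordered_ab_group_add set"
  assumes "finite A" "finite B" "A \<noteq> {}" "B \<noteq> {}"
  shows "card A + card B \<le> card (A + B) + 1"
proof -
  let ?X = "(\<lambda>x. x + Max B) ` A" and ?Y = "(\<lambda>y. y + Min A) ` B"
  have "?X \<inter> ?Y \<subseteq> {Min A + Max B}"
  proof
    fix z assume "z \<in> ?X \<inter> ?Y"
    then obtain x y where *: "x \<in> A" "y \<in> B" "z = x + Max B" "z = y + Min A" by auto
    moreover have "Min A \<le> x" "y \<le> Max B" using * assms by auto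
    ultimately show "z \<in> {Min A + Max B}"
      by (metis add.commute add_mono_thms_linordered_semiring(1) antisym add_le_cancel_left insertI1)
  qed
  then have "card (?X \<inter> ?Y) \<le> 1"
    using card_mono[of "{Min A + Max B}"] by fastforce
  moreover have "card (?X \<union> ?Y) + card (?X \<inter> ?Y) = card A + card B"
    using card_Un_Int[of ?X ?Y] assms by simp
  moreover have "?X \<union> ?Y \<subseteq> A + B"
    using assms set_plus_intro[of _ A "Max B" B] set_plus_intro[of "Min A" A _ B]
    by (auto simp: add.commute)
  then have "card (?X \<union> ?Y) \<le> card (A + B)"
    using assms by (intro card_mono finite_set_plus)
  ultimately show ?thesis by linarith
qed

lemma sumset_mono: "A \<subseteq> A' \<Longrightarrow> B \<subseteq> B' \<Longrightarrow> A + B \<subseteq> A' + B'" for A B :: "'a :: plus set"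
  by (rule set_plus_mono2)

lemma subset_sumset_zero: "0 \<in> B \<Longrightarrow> A \<subseteq> A + B" for A B :: "'a :: monoid_add set"
  by (metis add.right_neutral set_plus_intro subsetI)

text \<open>Each residue class met by \<open>A + B\<close> contains an element outside \<open>A\<close>: add \<open>m\<close> to the largest
  element of \<open>A\<close> in it.\<close>

lemma card_sumset_ge_residues:
  fixes A B :: "int set"
  assumes "finite A" "finite B" "0 \<in> B" "m \<in> B" "m > 0"
  shows "card A + card ((\<lambda>x. x mod m) ` (A + B)) \<le> card (A + B)"
proof -
  have sub: "A \<subseteq> A + B" using assms(3) by (rule subset_sumset_zero)
  have fin: "finite (A + B)" using assms by (intro finite_set_plus)
  have "(\<lambda>x. x mod m) ` (A + B) \<subseteq> (\<lambda>x. x mod m) ` (A + B - A)"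
  proof
    fix r assume "r \<in> (\<lambda>x. x mod m) ` (A + B)"
    then obtain x where x: "x \<in> A + B" "r = x mod m" by auto
    let ?C = "{a \<in> A. a mod m = r}"
    show "r \<in> (\<lambda>x. x mod m) ` (A + B - A)"
    proof (cases "?C = {}")
      case True
      then show ?thesis using x by auto
    next
      case False
      have finC: "finite ?C" using assms by simp
      have mC: "Max ?C \<in> ?C" using finC False by (rule Max_in)
      have "Max ?C + m \<notin> A"
      proof
        assume "Max ?C + m \<in> A"
        then have "Max ?C + m \<in> ?C" using mC by simp
        then have "Max ?C + m \<le> Max ?C" using finC by (intro Max_ge)
        then show False using assms by simp
      qed
      moreover have "Max ?C + m \<in> A + B" using mC assms by (intro set_plus_intro) auto
      ultimately show ?thesis using mC by (intro image_eqI[of _ _ "Max ?C + m"]) auto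
    qed
  qed
  then have "card ((\<lambda>x. x mod m) ` (A + B)) \<le> card (A + B - A)"
    using fin by (meson surj_card_le finite_Diff)
  also have "\<dots> = card (A + B) - card A" using sub assms by (intro card_Diff_subset)
  finally show ?thesis using card_mono[OF fin sub] by linarith
qed

text \<open>The part of \<open>Q\<close> in the class of \<open>q\<close> and the rest of
  \<open>Q\<close> give sums with \<open>P\<close> in different classes modulo \<open>g\<close>. The
  trivial bound applies to both parts and so counts \<open>P\<close> twice.\<close>

lemma card_sumset_two_classes:
  fixes P Q :: "int set"
  assumes "finite P" "finite Q" "P \<noteq> {}"
    and P: "\<And>x y. x \<in> P \<Longrightarrow> y \<in> P \<Longrightarrow> g dvd x - y"
    and q: "q \<in> Q" "q' \<in> Q" "\<not> g dvd q - q'"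
  shows "2 * card P + card Q \<le> card (P + Q) + 2"
proof -
  let ?Q1 = "{y \<in> Q. g dvd y - q}" and ?Q2 = "{y \<in> Q. \<not> g dvd y - q}"
  have ne: "?Q1 \<noteq> {}" "?Q2 \<noteq> {}"
    using q by (auto simp: dvd_diff_commute)
  have disj: "(P + ?Q1) \<inter> (P + ?Q2) = {}"
  proof (rule ccontr)
    assume "(P + ?Q1) \<inter> (P + ?Q2) \<noteq> {}"
    then obtain x y x' y' where *: "x \<in> P" "y \<in> ?Q1" "x' \<in> P" "y' \<in> ?Q2" "x + y = x' + y'"
      by (auto simp: set_plus_def)
    then have "y' - q = (x - x') + (y - q)" by linarith
    moreover have "g dvd (x - x') + (y - q)" using * P by (intro dvd_add) auto
    ultimately have "g dvd y' - q" by (rule ssubst)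
    then show False using * by auto
  qed
  have "card Q = card ?Q1 + card ?Q2"
    using assms by (subst card_Un_disjoint[symmetric]) (auto intro: arg_cong[of _ _ card])
  moreover have "card P + card ?Q1 \<le> card (P + ?Q1) + 1" "card P + card ?Q2 \<le> card (P + ?Q2) + 1"
    using assms ne by (intro card_sumset_ge; simp)+
  moreover have "card (P + ?Q1) + card (P + ?Q2) = card ((P + ?Q1) \<union> (P + ?Q2))"
    using disj assms by (intro card_Un_disjoint[symmetric] finite_set_plus) auto
  moreover have "(P + ?Q1) \<union> (P + ?Q2) \<subseteq> P + Q"
    by (intro Un_least sumset_mono) auto
  then have "card ((P + ?Q1) \<union> (P + ?Q2)) \<le> card (P + Q)"
    using assms by (intro card_mono finite_set_plus)
  ultimately show ?thesis by linarith
qed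

text \<open>If \<open>x\<close> is not a sum, then \<open>y \<mapsto> x - y\<close> maps the elements of \<open>A\<close> up to \<open>x\<close> to non-elements.\<close>

lemma card_below_non_sum:
  fixes A :: "int set"
  assumes "A \<subseteq> {0..N}" "x \<ge> 0" "x \<notin> A + A"
  shows "2 * int (card (A \<inter> {0..x})) \<le> x + 1"
proof -
  let ?X = "A \<inter> {0..x}" and ?Y = "(\<lambda>y. x - y) ` (A \<inter> {0..x})"
  have "?X \<inter> ?Y = {}"
    using assms(3) set_plus_intro[of _ A _ A] by fastforce
  moreover have "card ?Y = card ?X" by (rule card_image) (auto simp: inj_on_def)
  ultimately have "2 * card ?X = card (?X \<union> ?Y)" by (simp add: card_Un_disjoint)
  also have "\<dots> \<le> card {0..x}" by (intro card_mono) auto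
  finally show ?thesis using assms by simp
qed

text \<open>The mirror image of the previous bound, with the reflection
  \<open>y \<mapsto> x + N - y\<close>.\<close>

lemma card_above_non_sum:
  fixes A :: "int set"
  assumes "A \<subseteq> {0..N}" "x \<le> N" "x + N \<notin> A + A"
  shows "2 * int (card (A \<inter> {x..N})) \<le> N - x + 1"
proof -
  let ?X = "A \<inter> {x..N}" and ?Y = "(\<lambda>y. x + N - y) ` (A \<inter> {x..N})"
  have "?X \<inter> ?Y = {}"
    using assms(3) set_plus_intro[of _ A _ A] by fastforce
  moreover have "card ?Y = card ?X" by (rule card_image) (auto simp: inj_on_def)
  ultimately have "2 * card ?X = card (?X \<union> ?Y)" by (simp add: card_Un_disjoint)
  also have "\<dots> \<le> card {x..N}" by (intro card_mono) auto
  finally show ?thesis using assms by simp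
qed

text \<open>Let \<open>?L\<close> be the sums up to \<open>N\<close> and \<open>?R\<close> the sums
  from \<open>N\<close> on, shifted down by \<open>N\<close>. Together they cover
  \<open>{0..N}\<close>, and both contain \<open>A\<close> and the counted holes. Only the sum
  \<open>N\<close> is counted twice.\<close>

lemma card_sumset_ge_length:
  fixes A :: "int set"
  assumes A: "A \<subseteq> {0..N}" "0 \<in> A" "N \<in> A" and N: "N \<le> 2 * int (card A) - 3"
  shows "N + int (card A) + int (card {x \<in> {0..N} - A. x \<in> A + A \<and> x + N \<in> A + A}) \<le> int (card (A + A))"
proof -
  let ?E = "{x \<in> {0..N} - A. x \<in> A + A \<and> x + N \<in> A + A}"
  let ?L = "{x \<in> {0..N}. x \<in> A + A}" and ?R = "{x \<in> {0..N}. x + N \<in> A + A}"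
  have fin: "finite A" using A finite_subset by blast
  have N0: "0 \<le> N" using A by auto
  have sumI: "x \<in> A + A" "x + N \<in> A + A" if "x \<in> A" for x
    using that A set_plus_intro[of x A 0 A] set_plus_intro[of x A N A] by auto
  have finLR: "finite ?L" "finite ?R"
    using finite_subset[of ?L "{0..N}"] finite_subset[of ?R "{0..N}"] by blast+
  have cover: "?L \<union> ?R = {0..N}"
  proof -
    \<comment> \<open>For an uncovered \<open>x\<close> the two half-density bounds would add up to
      \<open>2 * card A \<le> N + 2\<close>.\<close>
    have "x \<in> ?L \<union> ?R" if x: "x \<in> {0..N}" for x
    proof (rule ccontr)
      assume not: "x \<notin> ?L \<union> ?R"
      then have "2 * int (card (A \<inter> {0..x})) \<le> x + 1" "2 * int (card (A \<inter> {x..N})) \<le> N - x + 1"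
        using x A card_below_non_sum[of A N x] card_above_non_sum[of A N x] by auto
      moreover have "card A \<le> card (A \<inter> {0..x}) + card (A \<inter> {x..N})"
        using card_Un_le[of "A \<inter> {0..x}" "A \<inter> {x..N}"] A
        by (smt (verit, best) Int_Un_distrib inf.absorb1 ivl_disj_un_two_touch(4) atLeastAtMost_iff x)
      ultimately show False using N by linarith
    qed
    then show ?thesis by (intro equalityI subsetI) (blast, blast)
  qed
  have "card A + card ?E = card (A \<union> ?E)" using fin
    by (intro card_Un_disjoint[symmetric] finite_subset[of ?E "{0..N}"]) auto
  also have "\<dots> \<le> card (?L \<inter> ?R)"
    using A sumI by (intro card_mono finite_subset[of "?L \<inter> ?R" "{0..N}"]) auto
  finally have 1: "card A + card ?E \<le> card (?L \<inter> ?R)" .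
  have 2: "card ?L + card ?R = card {0..N} + card (?L \<inter> ?R)"
    using card_Un_Int[OF finLR] cover by (simp only:)
  let ?R' = "(\<lambda>x. x + N) ` ?R"
  have "?L \<inter> ?R' \<subseteq> {N}" by auto
  then have "card (?L \<inter> ?R') \<le> 1" using card_mono[of "{N}"] by fastforce
  moreover have "card ?L + card ?R' = card (?L \<union> ?R') + card (?L \<inter> ?R')"
    using finLR by (intro card_Un_Int finite_imageI)
  moreover have "card ?R' = card ?R" by simp
  moreover have "card (?L \<union> ?R') \<le> card (A + A)"
    using fin by (intro card_mono finite_set_plus) auto
  ultimately have "card ?L + card ?R \<le> card (A + A) + 1" by linarith
  then show ?thesis using 1 2 N0 by simp
qed

section \<open>Periodic sets and the isoperimetric method\<close>

definition periodic :: "int \<Rightarrow> int set \<Rightarrow> bool" where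
  "periodic N X \<longleftrightarrow> (\<forall>x. x + N \<in> X \<longleftrightarrow> x \<in> X)"

text \<open>For periodic \<open>X\<close>, the size of the subset of the cyclic group of order
  \<open>N\<close> that \<open>X\<close> represents.\<close>

definition mu :: "int \<Rightarrow> int set \<Rightarrow> nat" where
  "mu N X = card (X \<inter> {0..<N})"

lemma periodic_add_mult:
  assumes "periodic N X"
  shows "x + N * j \<in> X \<longleftrightarrow> x \<in> X"
proof -
  have nat: "x + N * int i \<in> X \<longleftrightarrow> x \<in> X" for x i
  proof (induction i)
    case (Suc i)
    have "x + N * int (Suc i) = (x + N * int i) + N" by (simp add: algebra_simps)
    then show ?case using Suc assms by (metis periodic_def)
  qed simp
  show ?thesis
  proof (cases "j \<ge> 0")
    case True then show ?thesis using nat[of x "nat j"] by simp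
  next
    case False then show ?thesis using nat[of "x + N * j" "nat (- j)"] by (simp add: algebra_simps)
  qed
qed

lemma periodic_mod: "periodic N X \<Longrightarrow> x mod N \<in> X \<longleftrightarrow> x \<in> X"
  using periodic_add_mult[of N X "x mod N" "x div N"] by simp

lemma periodic_Un: "periodic N X \<Longrightarrow> periodic N Y \<Longrightarrow> periodic N (X \<union> Y)"
  and periodic_Int: "periodic N X \<Longrightarrow> periodic N Y \<Longrightarrow> periodic N (X \<inter> Y)"
  and periodic_Compl: "periodic N X \<Longrightarrow> periodic N (- X)"
  by (auto simp: periodic_def)

lemma periodic_uminus:
  assumes "periodic N X" shows "periodic N (uminus ` X)"
proof -
  have "x \<in> uminus ` X \<longleftrightarrow> - x \<in> X" for x by force
  then show ?thesis using assms periodic_add_mult[OF assms, of _ "-1"]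
    by (simp add: periodic_def)
qed

lemma periodic_translate: "periodic N X \<Longrightarrow> periodic N {y. y + t \<in> X}"
  unfolding periodic_def by (metis add.commute add.left_commute mem_Collect_eq)

lemma periodic_sumset:
  assumes "periodic N X" shows "periodic N (X + Y)"
  unfolding periodic_def
proof (intro allI iffI)
  fix x assume "x + N \<in> X + Y"
  then obtain a b where "a \<in> X" "b \<in> Y" "x + N = a + b" by (rule set_plus_elim)
  then have "a + N * (-1) \<in> X" "x = (a + N * (-1)) + b"
    using periodic_add_mult[OF assms, of a "-1"] by auto
  then show "x \<in> X + Y" using \<open>b \<in> Y\<close> by (blast intro: sumsetI)
next
  fix x assume "x \<in> X + Y"
  then obtain a b where "a \<in> X" "b \<in> Y" "x = a + b" by (rule set_plus_elim)
  then have "a + N \<in> X" "x + N = (a + N) + b"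
    using assms by (auto simp: periodic_def)
  then show "x + N \<in> X + Y" using \<open>b \<in> Y\<close> by (blast intro: sumsetI)
qed

lemma mu_mono: "X \<subseteq> Y \<Longrightarrow> mu N X \<le> mu N Y"
  unfolding mu_def by (intro card_mono) auto

lemma mu_Un_Int: "mu N (X \<union> Y) + mu N (X \<inter> Y) = mu N X + mu N Y"
  unfolding mu_def by (subst card_Un_Int) (auto simp: Int_Un_distrib2 intro: arg_cong[of _ _ card])

lemma mu_UNIV: "mu N UNIV = nat N"
  by (simp add: mu_def)

lemma mu_Compl: "mu N (- X) + mu N X = nat N"
  using mu_Un_Int[of N "- X" X] by (simp add: mu_UNIV) (simp add: mu_def)

lemma periodic_eqI:
  assumes "periodic N X" "periodic N Y" "X \<subseteq> Y" "mu N Y \<le> mu N X" "N > 0"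
  shows "X = Y"
proof -
  have "X \<inter> {0..<N} = Y \<inter> {0..<N}"
    using assms by (intro card_seteq) (auto simp: mu_def)
  then have "x mod N \<in> X \<longleftrightarrow> x mod N \<in> Y" for x
    using assms(5) pos_mod_bound[of N x] pos_mod_sign[of N x] by fastforce
  then show ?thesis using assms periodic_mod by blast
qed

lemma mu_translate:
  assumes "periodic N X" "N > 0"
  shows "mu N {y. y + t \<in> X} = mu N X"
proof -
  have per: "periodic N {y. y + t \<in> X}" using assms(1) by (rule periodic_translate)
  have shift: "(x - t) mod N + t \<in> X" if "x \<in> X" for x
    using that periodic_mod[OF per, of "x - t"] by simp
  have "bij_betw (\<lambda>y. (y + t) mod N) ({y. y + t \<in> X} \<inter> {0..<N}) (X \<inter> {0..<N})"
  proof (rule bij_betw_byWitness[where f' = "\<lambda>x. (x - t) mod N"])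
    show "(\<lambda>y. (y + t) mod N) ` ({y. y + t \<in> X} \<inter> {0..<N}) \<subseteq> X \<inter> {0..<N}"
      using assms periodic_mod by auto
    show "(\<lambda>x. (x - t) mod N) ` (X \<inter> {0..<N}) \<subseteq> {y. y + t \<in> X} \<inter> {0..<N}"
      using assms(2) shift by auto
  qed (auto simp: mod_simps)
  then show ?thesis unfolding mu_def by (rule bij_betw_same_card)
qed

lemma mu_uminus:
  assumes "periodic N X" "N > 0"
  shows "mu N (uminus ` X) = mu N X"
proof -
  have per: "periodic N (uminus ` X)" using assms(1) by (rule periodic_uminus)
  have "bij_betw (\<lambda>y. (- y) mod N) (uminus ` X \<inter> {0..<N}) (X \<inter> {0..<N})"
  proof (rule bij_betw_byWitness[where f' = "\<lambda>x. (- x) mod N"])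
    show "(\<lambda>y. (- y) mod N) ` (uminus ` X \<inter> {0..<N}) \<subseteq> X \<inter> {0..<N}"
      using assms periodic_mod by auto
    show "(\<lambda>x. (- x) mod N) ` (X \<inter> {0..<N}) \<subseteq> uminus ` X \<inter> {0..<N}"
      using assms periodic_mod[OF per] by auto
  qed (auto simp: mod_simps)
  then show ?thesis unfolding mu_def by (rule bij_betw_same_card)
qed

lemma mu_lt_imp_ne_UNIV: "mu N X < nat N \<Longrightarrow> X \<noteq> UNIV"
  using mu_UNIV by auto

text \<open>The hypotheses make \<open>M\<close> a subgroup. It is periodic with its least positive
  element \<open>n\<close> as period, so the remainder modulo \<open>n\<close> of any member is a
  member below \<open>n\<close>, hence 0.\<close>

lemma int_subgroup_multiples:
  fixes M :: "int set"
  assumes "0 \<in> M" "N \<in> M" "N > 0" and M: "\<And>x y. x \<in> M \<Longrightarrow> y + x \<in> M \<longleftrightarrow> y \<in> M"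
  shows "\<exists>d>0. M = {x. d dvd x}"
proof -
  have mult: "d * j \<in> M" if "d \<in> M" for d j
  proof -
    have "periodic d M" using M that by (auto simp: periodic_def)
    then show ?thesis using periodic_add_mult[of d M 0 j] assms by simp
  qed
  let ?P = "\<lambda>n. n > 0 \<and> int n \<in> M"
  define n where "n = Least ?P"
  have "?P (nat N)" using assms by simp
  then have n: "n > 0" "int n \<in> M" "\<And>m. ?P m \<Longrightarrow> n \<le> m"
    using LeastI[of ?P "nat N"] Least_le[of ?P] unfolding n_def by blast+
  have "int n dvd x" if x: "x \<in> M" for x
  proof -
    have "periodic (int n) M" using M n by (auto simp: periodic_def)
    then have "x mod int n \<in> M" using x periodic_mod by blast
    moreover have "0 \<le> x mod int n" "x mod int n < int n" using n by simp_all
    ultimately have "x mod int n = 0"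
      using n(3)[of "nat (x mod int n)"] by (cases "x mod int n = 0") auto
    then show ?thesis by presburger
  qed
  then have "M = {x. int n dvd x}" using mult[OF n(2)] by (auto elim!: dvdE)
  then show ?thesis using n by (intro exI[of _ "int n"]) auto
qed

text \<open>Hamidoune's atom argument. Among the admissible sets with the smallest boundary
  \<open>mu (X + S) - mu X\<close>, one of smallest size containing 0 is a subgroup: two intersecting translates
  of it coincide by submodularity. The bound \<open>2 * mu M + \<kappa> \<le> N\<close>, which keeps the union admissible,
  comes from comparing \<open>M\<close> with the reflected complement of \<open>M + S\<close>.\<close>

lemma minimal_boundary_subgroup:
  assumes N: "N > 0" and S: "periodic N S" "0 \<in> S"
    and X0: "periodic N X0" "X0 \<noteq> {}" "X0 + S \<noteq> UNIV"
  shows "\<exists>d>0. d dvd N \<and> {x. d dvd x} + S \<noteq> UNIV \<and>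
    mu N ({x. d dvd x} + S) + mu N X0 \<le> mu N (X0 + S) + mu N {x. d dvd x}"
proof -
  define adm where "adm X \<longleftrightarrow> periodic N X \<and> X \<noteq> {} \<and> X + S \<noteq> UNIV" for X
  \<comment> \<open>The truncated subtraction is exact, since \<open>0 \<in> S\<close> gives
    \<open>X \<subseteq> X + S\<close>.\<close>
  define bd where "bd X = mu N (X + S) - mu N X" for X
  have sub: "X \<subseteq> X + S" for X
    using S(2) by (metis add.right_neutral set_plus_intro subsetI)
  have bd_eq: "mu N (X + S) = mu N X + bd X" for X
    using mu_mono[OF sub] by (simp add: bd_def)
  have "adm X0" using X0 by (simp add: adm_def)
  then obtain F where F: "adm F" "\<And>X. adm X \<Longrightarrow> bd F \<le> bd X"
    using ex_has_least_nat[of adm X0 bd] by blast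
  define \<kappa> where "\<kappa> = bd F"
  obtain M0 where M0: "adm M0" "bd M0 = \<kappa>" "\<And>X. adm X \<Longrightarrow> bd X = \<kappa> \<Longrightarrow> mu N M0 \<le> mu N X"
    using ex_has_least_nat[of "\<lambda>X. adm X \<and> bd X = \<kappa>" F "mu N"] F \<kappa>_def by blast
  have translate_sum: "{y. y + t \<in> X} + S = {y. y + t \<in> X + S}" for t X
  proof safe
    fix x assume "x \<in> {y. y + t \<in> X} + S"
    then obtain a b where "a + t \<in> X" "b \<in> S" "x = a + b" by (auto elim: set_plus_elim)
    then show "x + t \<in> X + S" by (intro sumsetI[of "a + t" _ b]) auto
  next
    fix x assume "x + t \<in> X + S"
    then obtain a b where "a \<in> X" "b \<in> S" "x + t = a + b" by (auto elim: set_plus_elim)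
    then show "x \<in> {y. y + t \<in> X} + S"
      by (intro sumsetI[of "a - t" _ b]) auto
  qed
  have translate: "adm {y. y + t \<in> X}" "bd {y. y + t \<in> X} = bd X" 
      "mu N {y. y + t \<in> X} = mu N X" if X: "adm X" for t X
  proof -
    have per: "periodic N X" "periodic N (X + S)" using X by (auto simp: adm_def periodic_sumset)
    obtain a c where ac: "a \<in> X" "c \<notin> X + S" using X by (auto simp: adm_def)
    have "a - t \<in> {y. y + t \<in> X}" "c - t \<notin> {y. y + t \<in> X + S}" using ac by auto
    then show "adm {y. y + t \<in> X}"
      unfolding adm_def translate_sum[of t X] using periodic_translate[OF per(1)] by blast
    show "mu N {y. y + t \<in> X} = mu N X" by (rule mu_translate[OF per(1) N])
    then show "bd {y. y + t \<in> X} = bd X"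
      unfolding bd_def translate_sum[of t X] by (simp only: mu_translate[OF per(2) N])
  qed
  obtain a where "a \<in> M0" using M0 by (auto simp: adm_def)
  define M where "M = {y. y + a \<in> M0}"
  have M: "adm M" "bd M = \<kappa>" "0 \<in> M" "\<And>X. adm X \<Longrightarrow> bd X = \<kappa> \<Longrightarrow> mu N M \<le> mu N X"
    using translate[OF M0(1)] M0 \<open>a \<in> M0\<close> by (auto simp: M_def)
  have perM: "periodic N M" "periodic N (M + S)" using M(1) by (auto simp: adm_def periodic_sumset)
  have size: "2 * mu N M + \<kappa> \<le> nat N"
  proof -
    \<comment> \<open>\<open>D + S\<close> misses the reflection of \<open>M\<close>, so the
      boundary of \<open>D\<close> is at most \<open>\<kappa>\<close>. Hence \<open>D\<close> is
      optimal too, and minimality of \<open>M\<close> gives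
      \<open>mu N M \<le> mu N D = N - mu N M - \<kappa>\<close>.\<close>
    define D where "D = uminus ` (- (M + S))"
    have perD: "periodic N D" unfolding D_def using perM by (intro periodic_uminus periodic_Compl)
    have DS: "D + S \<subseteq> - (uminus ` M)"
    proof
      fix x assume "x \<in> D + S"
      then obtain y s where *: "y \<notin> M + S" "s \<in> S" "x = - y + s" by (auto simp: D_def elim: set_plus_elim)
      have False if "z \<in> M" "x = - z" for z
      proof -
        have "y = z + s" using * that by simp
        then show False using * that by (blast intro: sumsetI)
      qed
      then show "x \<in> - (uminus ` M)" by auto
    qed
    have muD: "mu N D + mu N (M + S) = nat N"
      unfolding D_def using mu_uminus[OF periodic_Compl[OF perM(2)] N] mu_Compl by metis
    have "0 \<in> uminus ` M" using M(3) by (auto intro: image_eqI[of _ _ 0])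
    moreover have "D \<noteq> {}" using M(1) by (auto simp: adm_def D_def)
    ultimately have admD: "adm D" unfolding adm_def using DS perD by blast
    have "mu N (D + S) + mu N M \<le> nat N"
      using mu_mono[OF DS, of N] mu_uminus[OF perM(1) N] mu_Compl[of N "uminus ` M"] by simp
    moreover have "bd D \<ge> \<kappa>" using F(2)[OF admD] \<kappa>_def by simp
    ultimately have "bd D = \<kappa>" using bd_eq[of D] bd_eq[of M] muD M(2) by linarith
    then have "mu N M \<le> mu N D" using M(4) admD by blast
    then show ?thesis using muD bd_eq[of M] M(2) by linarith
  qed
  have "y + x \<in> M \<longleftrightarrow> y \<in> M" if x: "x \<in> M" for x y
  proof -
    define Y where "Y = {y. y + x \<in> M}"
    have Y: "adm Y" "bd Y = \<kappa>" "mu N Y = mu N M" "0 \<in> Y"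
      using translate[OF M(1)] M x by (auto simp: Y_def)
    have perY: "periodic N Y" using Y(1) by (simp add: adm_def)
    have perI: "periodic N (M \<inter> Y)" and perU: "periodic N (M \<union> Y)"
      using perM perY by (auto intro: periodic_Int periodic_Un)
    have "M = Y"
    \<comment> \<open>If \<open>M \<noteq> Y\<close>, the intersection is smaller than
      \<open>M\<close> and admissible, so its boundary is at least \<open>\<kappa> + 1\<close>. By
      submodularity the union then has boundary below \<open>\<kappa>\<close>, and by
      \<open>size\<close> it is admissible, against the choice of \<open>\<kappa>\<close>.\<close>
    proof (rule ccontr)
      assume ne: "M \<noteq> Y"
      have "mu N (M \<inter> Y) < mu N M"
      proof (rule ccontr)
        assume *: "\<not> mu N (M \<inter> Y) < mu N M"
        have "M \<inter> Y = M" using * by (intro periodic_eqI[OF perI perM(1)] N) auto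
        moreover have "M \<inter> Y = Y" using * Y(3) by (intro periodic_eqI[OF perI perY] N) auto
        ultimately show False using ne by blast
      qed
      moreover have IS: "(M \<inter> Y) + S \<subseteq> (M + S) \<inter> (Y + S)"
        by (intro Int_greatest set_plus_mono2) auto
      then have admI: "adm (M \<inter> Y)" using M(1,3) Y(4) perI by (auto simp: adm_def)
      ultimately have "bd (M \<inter> Y) \<noteq> \<kappa>" using M(4) by fastforce
      moreover have "\<kappa> \<le> bd (M \<inter> Y)" using F(2)[OF admI] \<kappa>_def by simp
      ultimately have 1: "\<kappa> + 1 \<le> bd (M \<inter> Y)" by simp
      have US: "(M \<union> Y) + S = (M + S) \<union> (Y + S)" by (auto simp: set_plus_def)
      have "mu N ((M \<union> Y) + S) + mu N ((M \<inter> Y) + S) \<le> mu N (M + S) + mu N (Y + S)"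
        unfolding US using mu_Un_Int[of N "M + S" "Y + S"] mu_mono[OF IS, of N]
        by (metis add_left_mono)
      then have 2: "mu N ((M \<union> Y) + S) + mu N ((M \<inter> Y) + S) \<le> 2 * (mu N M + \<kappa>)"
        using bd_eq[of M] bd_eq[of Y] M(2) Y(2,3) by simp
      then have "mu N ((M \<union> Y) + S) < nat N" 
        using 1 2 size bd_eq[of "M \<inter> Y"] by simp
      then have "adm (M \<union> Y)" using mu_lt_imp_ne_UNIV perU M(3) by (auto simp: adm_def)
      then have "\<kappa> \<le> bd (M \<union> Y)" using F(2) \<kappa>_def by simp
      moreover have "mu N (M \<union> Y) + mu N (M \<inter> Y) = 2 * mu N M" using mu_Un_Int[of N M Y] Y(3) by simp
      ultimately show False
        using 1 2 unfolding bd_eq[of "M \<inter> Y"] bd_eq[of "M \<union> Y"] by simp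
    qed
    then show ?thesis unfolding Y_def by blast
  qed
  moreover have "N \<in> M" using M(3) perM(1) by (metis add_0 periodic_def)
  ultimately obtain d where d: "d > 0" "M = {x. d dvd x}"
    using int_subgroup_multiples[OF M(3) _ N] by blast
  have "\<kappa> \<le> bd X0" using F(2)[OF \<open>adm X0\<close>] \<kappa>_def by simp
  then have "mu N (M + S) + mu N X0 \<le> mu N (X0 + S) + mu N M"
    using bd_eq[of M] bd_eq[of X0] M(2) by linarith
  then show ?thesis using d M(1) \<open>N \<in> M\<close> by (auto simp: adm_def)
qed

section \<open>Doubling in cyclic groups\<close>

lemma mu_residues:
  assumes "d > 0" "d dvd N" "N > 0" "T \<subseteq> {0..<d}"
  shows "mu N {x. x mod d \<in> T} = card T * nat (N div d)"
proof -
  obtain n where N: "N = d * n" using assms(2) by blast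
  have "n > 0" using assms N by (simp add: zero_less_mult_iff)
  have "bij_betw (\<lambda>x. (x mod d, x div d)) ({x. x mod d \<in> T} \<inter> {0..<N}) (T \<times> {0..<n})"
  proof (rule bij_betw_byWitness[where f' = "\<lambda>(t, j). t + d * j"])
    have "x div d < n" if "x < d * n" for x
    proof -
      have "d * (x div d) \<le> x" using assms(1) by (simp add: minus_mod_eq_mult_div[symmetric])
      then have "d * (x div d) < d * n" using that by linarith
      then show ?thesis using assms(1) by simp
    qed
    then show "(\<lambda>x. (x mod d, x div d)) ` ({x. x mod d \<in> T} \<inter> {0..<N}) \<subseteq> T \<times> {0..<n}"
      using assms(1) unfolding N by (auto simp: pos_imp_zdiv_nonneg_iff)
    have "t + d * j < d * n" if "t < d" "j < n" for t j
    proof -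
      have "d * (j + 1) \<le> d * n" using that assms(1) by (intro mult_left_mono) auto
      then show ?thesis using that by (simp add: algebra_simps)
    qed
    then show "(\<lambda>(t, j). t + d * j) ` (T \<times> {0..<n}) \<subseteq> {x. x mod d \<in> T} \<inter> {0..<N}"
      using assms(1,4) unfolding N by (fastforce simp: mod_pos_pos_trivial)
  qed (use assms in \<open>auto simp: mod_pos_pos_trivial div_pos_pos_trivial subset_iff\<close>)
  then have "mu N {x. x mod d \<in> T} = card (T \<times> {0..<n})"
    unfolding mu_def by (rule bij_betw_same_card)
  then show ?thesis using N assms by (simp add: card_cartesian_product)
qed

lemma mu_multiples: "d > 0 \<Longrightarrow> d dvd N \<Longrightarrow> N > 0 \<Longrightarrow> mu N {x. d dvd x} = nat (N div d)"
  using mu_residues[of d N "{0}"] by (simp add: dvd_eq_mod_eq_0)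

lemma sumset_multiples: "{x. d dvd x} + {x. e dvd x} = {x. gcd d e dvd x}" for d e :: int
proof (intro equalityI subsetI)
  fix x assume "x \<in> {x. d dvd x} + {x. e dvd x}"
  then obtain a b where "d dvd a" "e dvd b" "x = a + b" by (auto elim: set_plus_elim)
  then show "x \<in> {x. gcd d e dvd x}" by (auto intro: dvd_add dvd_trans[OF gcd_dvd1] dvd_trans[OF gcd_dvd2])
next
  fix x assume "x \<in> {x. gcd d e dvd x}"
  then obtain z where "x = gcd d e * z" by auto
  moreover obtain u v where "u * d + v * e = gcd d e" using bezout_int by blast
  ultimately have "x = d * (u * z) + e * (v * z)" by (metis (no_types) distrib_right mult.assoc mult.commute)
  then show "x \<in> {x. d dvd x} + {x. e dvd x}" by (intro sumsetI[of "d * (u * z)" _ "e * (v * z)"]) auto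
qed

text \<open>A weak form of Kneser's theorem for \<open>S + S\<close>. Among the subgroups \<open>d\<int>\<close> with the first two
  properties take the largest; \<open>minimal_boundary_subgroup\<close> for \<open>d\<int> + S\<close> yields a larger one if the
  last property fails.\<close>

lemma doubling_mod_subgroup:
  assumes N: "N > 0" and S: "periodic N S" "0 \<in> S" "S \<noteq> UNIV"
  obtains d where "d > 0" "d dvd N" "{x. d dvd x} + S \<noteq> UNIV"
    "mu N ({x. d dvd x} + S) + 1 \<le> mu N S + nat (N div d)"
    "({x. d dvd x} + S) + ({x. d dvd x} + S) = UNIV \<or>
     2 * mu N ({x. d dvd x} + S) \<le> mu N (({x. d dvd x} + S) + ({x. d dvd x} + S)) + nat (N div d)"
proof -
  define Z where "Z d = {x. d dvd x}" for d :: int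
  \<comment> \<open>The largest subgroup has the least generator, which \<open>Least\<close> selects
    among the naturals.\<close>
  define P where "P m \<longleftrightarrow> m > 0 \<and> int m dvd N \<and> Z (int m) + S \<noteq> UNIV \<and>
    mu N (Z (int m) + S) + 1 \<le> mu N S + nat (N div int m)" for m :: nat
  \<comment> \<open>This makes \<open>N\<close> a candidate: it stands for the trivial subgroup of
    the cyclic group, with \<open>N div N = 1\<close>.\<close>
  have "Z N + S = S"
  proof
    show "S \<subseteq> Z N + S" by (auto simp: Z_def intro: sumsetI[of 0])
    show "Z N + S \<subseteq> S"
      using periodic_add_mult[OF S(1)] by (auto simp: Z_def add.commute elim!: set_plus_elim dvdE)
  qed
  then have "P (nat N)" using N S by (simp add: P_def)
  define m where "m = Least P"
  have m: "P m" "\<And>m'. P m' \<Longrightarrow> m \<le> m'"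
    using LeastI[of P "nat N"] Least_le[of P] \<open>P (nat N)\<close> unfolding m_def by blast+
  define d where "d = int m"
  define S' where "S' = Z d + S"
  have d: "d > 0" "d dvd N" "S' \<noteq> UNIV" "mu N S' + 1 \<le> mu N S + nat (N div d)"
    using m(1) by (auto simp: P_def d_def S'_def)
  have perZ: "periodic N (Z d)" using d(2) by (simp add: Z_def periodic_def dvd_add_left_iff)
  have S': "periodic N S'" "0 \<in> S'" using S(2) perZ
    by (auto simp: S'_def Z_def periodic_sumset intro: sumsetI[of 0])
  have "S' + S' = UNIV \<or> 2 * mu N S' \<le> mu N (S' + S') + nat (N div d)"
  proof (rule ccontr)
    assume not: "\<not> ?thesis"
    obtain e where e: "e > 0" "e dvd N" "Z e + S' \<noteq> UNIV"
      "mu N (Z e + S') + mu N S' \<le> mu N (S' + S') + mu N (Z e)"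
      using minimal_boundary_subgroup[OF N S' S'(1)] S'(2) not unfolding Z_def by blast
    \<comment> \<open>Adding \<open>e\<int>\<close> to \<open>S'\<close> amounts to adding
      \<open>g\<int>\<close> to \<open>S\<close>. The bounds \<open>lt\<close> and
      \<open>d(4)\<close> give \<open>P\<close> for \<open>g\<close>, so minimality forces
      \<open>g = d\<close> and \<open>d dvd e\<close>. Then \<open>lt\<close> contradicts
      \<open>S' \<subseteq> Z e + S'\<close>.\<close>
    define g where "g = gcd d e"
    have g: "g > 0" "g dvd N" "g dvd d" "g dvd e" "g \<le> d"
      using d(1,2) by (auto simp: g_def intro: dvd_trans zdvd_imp_le)
    have ZS: "Z e + S' = Z g + S"
      unfolding S'_def g_def Z_def sumset_multiples[symmetric] by (simp add: add_ac)
    have muZ: "mu N (Z e) = nat (N div e)" using mu_multiples e N unfolding Z_def by blast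
    have lt: "mu N (Z e + S') + nat (N div d) < mu N S' + nat (N div e)"
      using not e(4) unfolding muZ by simp
    have "N div e \<le> N div g"
      using zdvd_imp_le[OF g(4) e(1)] N g(1) by (intro zdiv_mono2) auto
    then have "P (nat g)" using lt d(4) e(3) g unfolding P_def ZS by auto
    then have "g = d" using m(2) g d_def by fastforce
    then have "d dvd e" using g by simp
    then have "N div e \<le> N div d" using N d(1) e(1) zdvd_imp_le by (intro zdiv_mono2) auto
    moreover have "mu N S' \<le> mu N (Z e + S')" by (intro mu_mono) (auto simp: Z_def intro: sumsetI[of 0])
    ultimately show False using lt by linarith
  qed
  then show ?thesis using that[of d] d unfolding S'_def Z_def by blast
qed

lemma card_eq_sum_fibres:
  assumes "finite X" "finite T" "f ` X \<subseteq> T"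
  shows "card X = (\<Sum>c\<in>T. card {x \<in> X. f x = c})"
  using sum.group[OF assms, of "\<lambda>_. 1 :: nat"] by simp

text \<open>Pigeonhole: for \<open>r\<close> in the class of \<open>p + q\<close>, both
  \<open>P\<close> and \<open>r - Q\<close> modulo \<open>N\<close> lie in the class of
  \<open>p\<close>, which has only \<open>N div d\<close> elements, so they meet.\<close>

lemma sumset_covers_class:
  fixes P Q :: "int set"
  assumes d: "d > 0" "d dvd N" "N > 0" and fin: "finite P" "finite Q"
    and P: "P \<subseteq> {0..<N}" "\<And>x. x \<in> P \<Longrightarrow> x mod d = p mod d"
    and Q: "Q \<subseteq> {0..<N}" "\<And>x. x \<in> Q \<Longrightarrow> x mod d = q mod d"
    and card: "nat (N div d) < card P + card Q"
  shows "nat (N div d) \<le> card ((\<lambda>x. x mod N) ` (P + Q))"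
proof -
  define C where "C c = {x \<in> {0..<N}. x mod d = c mod d}" for c
  have cardC: "card (C c) = nat (N div d)" for c
  proof -
    have "C c = {x. x mod d \<in> {c mod d}} \<inter> {0..<N}" by (auto simp: C_def)
    then show ?thesis using mu_residues[OF d, of "{c mod d}"] d(1) by (simp add: mu_def)
  qed
  have finC: "finite (C c)" for c by (rule finite_subset[of _ "{0..<N}"]) (auto simp: C_def)
  have "C (p + q) \<subseteq> (\<lambda>x. x mod N) ` (P + Q)"
  proof
    fix r assume r: "r \<in> C (p + q)"
    let ?Q = "(\<lambda>y. (r - y) mod N) ` Q"
    have "inj_on (\<lambda>y. (r - y) mod N) Q"
    proof (rule inj_onI)
      fix y y' assume *: "y \<in> Q" "y' \<in> Q" "(r - y) mod N = (r - y') mod N"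
      then have "(r - (r - y) mod N) mod N = (r - (r - y') mod N) mod N" by simp
      then have "y mod N = y' mod N" by (simp add: mod_simps)
      then show "y = y'" using * Q(1) by (auto simp: subset_iff)
    qed
    then have cardQ: "card ?Q = card Q" by (rule card_image)
    have "(r - y) mod N mod d = p mod d" if "y \<in> Q" for y
    proof -
      have "(r - y) mod N mod d = (r mod d - y mod d) mod d"
        using d(2) by (simp add: mod_mod_cancel mod_simps)
      also have "\<dots> = ((p + q) mod d - q mod d) mod d" using r Q(2)[OF that] by (simp add: C_def)
      also have "\<dots> = p mod d" by (simp add: mod_simps)
      finally show ?thesis .
    qed
    then have "P \<union> ?Q \<subseteq> C p" using P d(3) by (auto simp: C_def)
    then have "card (P \<union> ?Q) \<le> nat (N div d)"
      unfolding cardC[of p, symmetric] by (intro card_mono finC)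
    then have "P \<inter> ?Q \<noteq> {}"
      using card cardQ fin card_Un_disjoint[of P ?Q] by fastforce
    then obtain y where y: "y \<in> Q" "(r - y) mod N \<in> P" by auto
    have "((r - y) mod N + y) mod N = r" using r by (simp add: mod_simps C_def)
    then show "r \<in> (\<lambda>x. x mod N) ` (P + Q)"
      using y by (intro image_eqI[of _ _ "(r - y) mod N + y"]) auto
  qed
  then show ?thesis using fin cardC[of "p + q"]
    by (metis card_mono finite_imageI finite_set_plus)
qed

section \<open>Freiman's theorem\<close>

text \<open>Freiman's \<open>3k - 4\<close> theorem, in contrapositive form for a set in normal form. Let \<open>d\<int>\<close> be the
  subgroup from \<open>doubling_mod_subgroup\<close> for \<open>A\<close> modulo \<open>N\<close>. The set \<open>A\<close> fills the classes modulo \<open>d\<close>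
  that it meets so well that two distinct ones add up to a full class modulo \<open>N\<close>, which bounds
  \<open>A + A\<close> in each class modulo \<open>d\<close>.\<close>

lemma card_sumset_ge_3k_minus_3:
  fixes A :: "int set"
  assumes A: "A \<subseteq> {0..N}" "0 \<in> A" "N \<in> A" and gcd: "\<And>d. (\<And>a. a \<in> A \<Longrightarrow> d dvd a) \<Longrightarrow> is_unit d"
    and N: "N > 0" "N \<ge> 2 * int (card A) - 2"
  shows "3 * card A \<le> card (A + A) + 3"
proof -
  define k where "k = card A"
  have finA: "finite A" using A(1) finite_subset by blast
  have finAA: "finite (A + A)" using finA by (intro finite_set_plus)
  \<comment> \<open>Since 0 and \<open>N\<close> coincide modulo \<open>N\<close>, dropping
    \<open>N\<close> leaves one representative of each residue of \<open>A\<close>.\<close>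
  define A' where "A' = A \<inter> {0..<N}"
  have A': "A' \<subseteq> {0..<N}" "0 \<in> A'" "finite A'" using A N finA by (auto simp: A'_def)
  have "A = insert N A'" "N \<notin> A'" using A by (auto simp: A'_def)
  then have cardA': "card A' + 1 = k" using A'(3) by (simp add: k_def)
  define S where "S = {x. x mod N \<in> A'}"
  have perS: "periodic N S" by (simp add: S_def periodic_def)
  have AS: "a \<in> S" if "a \<in> A" for a
    using that A A' N(1) by (cases "a = N") (auto simp: S_def A'_def)
  have muS: "mu N S = card A'"
    using mu_residues[of N N A'] A' N(1) unfolding S_def by simp
  have "S \<noteq> UNIV"
    using muS cardA' N unfolding k_def by (intro mu_lt_imp_ne_UNIV[of N]) linarith
  then obtain d where d: "d > 0" "d dvd N" "{x. d dvd x} + S \<noteq> UNIV"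
    "mu N ({x. d dvd x} + S) + 1 \<le> mu N S + nat (N div d)"
    "({x. d dvd x} + S) + ({x. d dvd x} + S) = UNIV \<or>
     2 * mu N ({x. d dvd x} + S) \<le> mu N (({x. d dvd x} + S) + ({x. d dvd x} + S)) + nat (N div d)"
    using doubling_mod_subgroup[OF N(1) perS AS[OF A(2)]] by metis

  \<comment> \<open>Residue classes of \<open>A\<close> and \<open>A + A\<close> modulo
    \<open>d\<close>\<close>
  define n where "n = nat (N div d)"
  have dn: "N = d * int n" using d N by (simp add: n_def pos_imp_zdiv_nonneg_iff)
  have n0: "n > 0" using dn N(1) by (cases n) auto
  define T where "T = (\<lambda>a. a mod d) ` A"
  define T2 where "T2 = (\<lambda>a. a mod d) ` (A + A)"
  have T: "T \<subseteq> {0..<d}" "finite T" "T2 \<subseteq> {0..<d}" "finite T2" "T \<subseteq> T2" "0 \<in> T"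
    using d(1) finA finAA A(2) subset_sumset_zero[OF A(2), of A] unfolding T_def T2_def by force+
  have ZS: "{x. d dvd x} + S = {x. x mod d \<in> T}"
  proof (intro equalityI subsetI)
    fix x assume "x \<in> {x. d dvd x} + S"
    then obtain z y where zy: "d dvd z" "y mod N \<in> A" "x = z + y"
      by (auto simp: S_def A'_def elim: set_plus_elim)
    then have "x mod d = y mod N mod d" using d(2) by (auto simp: mod_mod_cancel)
    then show "x \<in> {x. x mod d \<in> T}" using zy by (auto simp: T_def)
  next
    fix x assume "x \<in> {x. x mod d \<in> T}"
    then obtain a where "a \<in> A" "x mod d = a mod d" by (auto simp: T_def)
    then show "x \<in> {x. d dvd x} + S"
      using AS by (intro sumsetI[of "x - a" _ a]) (auto simp: mod_eq_dvd_iff)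
  qed
  have ZS2: "({x. d dvd x} + S) + ({x. d dvd x} + S) = {x. x mod d \<in> T2}"
    unfolding ZS
  proof (intro equalityI subsetI)
    fix x assume "x \<in> {x. x mod d \<in> T} + {x. x mod d \<in> T}"
    then obtain u v a b where *: "a \<in> A" "b \<in> A" "u mod d = a mod d" "v mod d = b mod d" "x = u + v"
      by (auto simp: T_def elim!: set_plus_elim)
    then have "x mod d = (a + b) mod d" by (metis mod_add_cong)
    then show "x \<in> {x. x mod d \<in> T2}" using * by (auto simp: T2_def)
  next
    fix x assume "x \<in> {x. x mod d \<in> T2}"
    then obtain a b where *: "a \<in> A" "b \<in> A" "x mod d = (a + b) mod d"
      by (auto simp: T2_def elim!: set_plus_elim)
    then have "(x - b) mod d = a mod d" by (simp add: mod_eq_dvd_iff algebra_simps)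
    then show "x \<in> {x. x mod d \<in> T} + {x. x mod d \<in> T}"
      using * by (intro sumsetI[of "x - b" _ b]) (auto simp: T_def)
  qed
  define s where "s = card T"
  have muT: "mu N ({x. d dvd x} + S) = s * n"
    unfolding ZS n_def s_def by (intro mu_residues d N T)
  have muT2: "mu N (({x. d dvd x} + S) + ({x. d dvd x} + S)) = card T2 * n"
    unfolding ZS2 n_def by (intro mu_residues d N T)
  \<comment> \<open>Within the \<open>s\<close> classes that it meets, \<open>A'\<close> misses
    fewer than \<open>n\<close> residues modulo \<open>N\<close>.\<close>
  have dense: "s * n + 1 \<le> card A' + n" using d(4) unfolding muT muS n_def .
  have "s \<ge> 1" using T unfolding s_def by (metis One_nat_def Suc_leI card_gt_0_iff empty_iff)
  have "s \<noteq> 1"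
  proof
    assume "s = 1"
    then have "T = {0}" using T(6) unfolding s_def by (metis card_1_singletonE singletonD)
    then have "d dvd a" if "a \<in> A" for a using that by (auto simp: T_def dvd_eq_mod_eq_0)
    then have "is_unit d" by (rule gcd)
    then have "d = 1" using d(1) by simp
    then show False using d(3) ZS \<open>T = {0}\<close> by auto
  qed
  then have s2: "s \<ge> 2" using \<open>s \<ge> 1\<close> by simp
  \<comment> \<open>If the double is everything, then \<open>card T2 = d\<close>, and
    \<open>dense\<close> with \<open>N \<ge> 2 * k - 2\<close> gives \<open>2 * s - 2 < d\<close>.
    Otherwise this is the last property of \<open>d\<close> divided by \<open>n\<close>.\<close>
  have cardT2: "2 * s \<le> card T2 + 1"
  proof (cases "({x. d dvd x} + S) + ({x. d dvd x} + S) = UNIV")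
    case True
    then have "card T2 * n = d * int n" using muT2 mu_UNIV[of N] dn N(1) by simp
    then have cT2: "int (card T2) = d" using n0 by simp
    have "int s * int n + 1 \<le> int k - 1 + int n" using dense cardA' by (simp flip: of_nat_mult)
    then have "2 * (int s * int n) - 2 * int n + 2 \<le> d * int n"
      using N(2) dn unfolding k_def by linarith
    then have "(2 * int s - 2) * int n < d * int n" by (simp add: algebra_simps)
    then have "2 * int s - 2 < d" using n0 by simp
    then show ?thesis using cT2 by linarith
  next
    case False
    then have "2 * (s * n) \<le> card T2 * n + n" using d(5) unfolding muT muT2 n_def by simp
    then have "(2 * s) * n \<le> (card T2 + 1) * n" by (simp add: algebra_simps)
    then show ?thesis using n0 by (rule mult_right_le_imp_le)
  qed

  \<comment> \<open>Lower bounds for \<open>A + A\<close> in each class\<close>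
  define Ac where "Ac c = {a \<in> A'. a mod d = c}" for c
  define \<alpha> where "\<alpha> c = card (Ac c)" for c
  define D where "D c = card {x \<in> A + A. x mod d = c}" for c
  have finAc: "finite (Ac c)" for c using A'(3) by (simp add: Ac_def)
  have T_mod: "c mod d = c" if "c \<in> T2" for c using that by (auto simp: T2_def)
  have AcT: "Ac c \<noteq> {}" if c: "c \<in> T" for c
  proof -
    obtain a where a: "a \<in> A" "c = a mod d" using c by (auto simp: T_def)
    show ?thesis
    proof (cases "a = N")
      case True
      then show ?thesis using a d(2) A' by (auto simp: Ac_def)
    next
      case False
      then have "a \<in> A'" using a A(1) by (auto simp: A'_def subset_iff)
      then show ?thesis using a by (auto simp: Ac_def)
    qed
  qed
  have \<alpha>_le: "\<alpha> c \<le> n" if "c \<in> T" for c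
  proof -
    have "Ac c \<subseteq> {x. x mod d \<in> {c}} \<inter> {0..<N}" using A' by (auto simp: Ac_def)
    then have "\<alpha> c \<le> mu N {x. x mod d \<in> {c}}"
      unfolding \<alpha>_def mu_def by (intro card_mono) auto
    also have "\<dots> = card {c} * nat (N div d)" using that T by (intro mu_residues d N) auto
    finally show ?thesis by (simp add: n_def)
  qed
  have sum_\<alpha>: "(\<Sum>c\<in>T. \<alpha> c) = card A'"
    unfolding \<alpha>_def Ac_def using A' T
    by (intro card_eq_sum_fibres[symmetric]) (auto simp: A'_def T_def)
  \<comment> \<open>\<open>h c\<close> counts the holes of \<open>A'\<close> in the class
    \<open>c\<close> modulo \<open>N\<close>. All holes together number \<open>H < n\<close>, so any
    two distinct classes of \<open>T\<close> satisfy the pigeonhole condition of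
    \<open>sumset_covers_class\<close>.\<close>
  define h where "h c = int n - int (\<alpha> c)" for c
  define H where "H = (\<Sum>c\<in>T. h c)"
  have h0: "h c \<ge> 0" if "c \<in> T" for c using \<alpha>_le[OF that] by (simp add: h_def)
  have H: "H = int s * int n - int (card A')"
    unfolding H_def h_def sum_subtractf by (simp add: s_def flip: sum_\<alpha>)
  have Hn: "H < int n" using H dense by (simp flip: of_nat_mult)
  have subset_h: "sum h X \<le> H" if "X \<subseteq> T" for X
    unfolding H_def using that T(2) h0 by (intro sum_mono2) auto
  have H0: "H \<ge> 0" using subset_h[of "{}"] by simp
  have pair: "n < \<alpha> i + \<alpha> j" if "i \<in> T" "j \<in> T" "i \<noteq> j" for i j
    using subset_h[of "{i, j}"] that Hn by (simp add: h_def)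
  have cover: "n \<le> card ((\<lambda>x. x mod N) ` (Ac i + Ac j))" if "n < \<alpha> i + \<alpha> j" "i \<in> T" "j \<in> T" for i j
    unfolding n_def
    by (rule sumset_covers_class[OF d(1,2) N(1), of _ _ i j])
      (use A' finAc that T T_mod in \<open>auto simp: Ac_def n_def \<alpha>_def\<close>)
  have Ac_sum: "Ac i + Ac j \<subseteq> {x \<in> A + A. x mod d = (i + j) mod d}" for i j
  proof
    fix x assume "x \<in> Ac i + Ac j"
    then obtain a b where *: "a \<in> Ac i" "b \<in> Ac j" "x = a + b" by (rule set_plus_elim)
    then have "x mod d = (i + j) mod d" by (auto simp: Ac_def mod_simps)
    then show "x \<in> {x \<in> A + A. x mod d = (i + j) mod d}"
      using * by (auto simp: Ac_def A'_def)
  qed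
  have D_ge: "card (Ac i + Ac j) \<le> D ((i + j) mod d)" for i j
    unfolding D_def using finAA by (intro card_mono Ac_sum) auto
  have D_full: "n \<le> D ((i + j) mod d)" if "n < \<alpha> i + \<alpha> j" "i \<in> T" "j \<in> T" for i j
    using cover[OF that] D_ge[of i j] card_image_le[OF finite_set_plus[OF finAc finAc], of "\<lambda>x. x mod N" i j]
    by linarith
  have D_trivial: "\<alpha> i + \<alpha> j \<le> D ((i + j) mod d) + 1" if "i \<in> T" "j \<in> T" for i j
    using card_sumset_ge[OF finAc finAc AcT AcT, OF that] D_ge[of i j] unfolding \<alpha>_def by linarith
  let ?A0 = "insert N (Ac 0)"
  have A0: "N \<notin> Ac 0" "?A0 \<subseteq> A" "\<And>x. x \<in> ?A0 \<Longrightarrow> x mod d = 0"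
    using A d(2) by (auto simp: Ac_def A'_def)
  \<comment> \<open>The zero class of \<open>A\<close> also contains \<open>N\<close>, so it has
    \<open>\<alpha> 0 + 1\<close> elements; this is the trivial bound for it.\<close>
  have D0: "2 * \<alpha> 0 + 1 \<le> D 0"
  proof -
    have "?A0 + ?A0 \<subseteq> {x \<in> A + A. x mod d = 0}"
    proof
      fix x assume "x \<in> ?A0 + ?A0"
      then obtain a b where *: "a \<in> ?A0" "b \<in> ?A0" "x = a + b" by (rule set_plus_elim)
      then have "(a + b) mod d = 0" using A0(3) by (metis add_0 mod_0 mod_add_eq)
      moreover have "x \<in> A + A" using * A0(2) by (intro sumsetI[of a _ b]) auto
      ultimately show "x \<in> {x \<in> A + A. x mod d = 0}" using *(3) by simp
    qed
    then have "card (?A0 + ?A0) \<le> D 0" unfolding D_def using finAA by (intro card_mono) auto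
    then show ?thesis
      using card_sumset_ge[of ?A0 ?A0] A0(1) finAc by (simp add: \<alpha>_def)
  qed
  \<comment> \<open>Adding the zero class, which contains 0 and \<open>N\<close>, gives
    \<open>\<alpha> c\<close> plus the number of residues modulo \<open>N\<close> by
    \<open>card_sumset_ge_residues\<close>; by \<open>pair\<close> and \<open>cover\<close> there
    are at least \<open>n\<close> residues.\<close>
  have DT: "n + \<alpha> c \<le> D c" if c: "c \<in> T" "c \<noteq> 0" for c
  proof -
    have "Ac c + ?A0 \<subseteq> {x \<in> A + A. x mod d = c}"
    proof
      fix x assume "x \<in> Ac c + ?A0"
      then obtain a b where *: "a \<in> Ac c" "b \<in> ?A0" "x = a + b" by (rule set_plus_elim)
      then have "(a + b) mod d = (c + 0) mod d"
        using A0(3)[of b] T_mod T c(1) by (intro mod_add_cong) (auto simp: Ac_def)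
      then have "x mod d = c" using * T_mod T c(1) by auto
      moreover have "a \<in> A" using * by (auto simp: Ac_def A'_def)
      then have "x \<in> A + A" using * A0(2) by (intro sumsetI[of a _ b]) auto
      ultimately show "x \<in> {x \<in> A + A. x mod d = c}" by simp
    qed
    then have "card (Ac c + ?A0) \<le> D c" unfolding D_def using finAA by (intro card_mono) auto
    moreover have "\<alpha> c + card ((\<lambda>x. x mod N) ` (Ac c + ?A0)) \<le> card (Ac c + ?A0)"
      unfolding \<alpha>_def using finAc A' N(1) by (intro card_sumset_ge_residues) (auto simp: Ac_def)
    moreover have "n \<le> card ((\<lambda>x. x mod N) ` (Ac c + Ac 0))"
      using pair c T by (intro cover) auto
    moreover have "card ((\<lambda>x. x mod N) ` (Ac c + Ac 0)) \<le> card ((\<lambda>x. x mod N) ` (Ac c + ?A0))"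
      using finAc by (intro card_mono finite_imageI finite_set_plus image_mono sumset_mono) auto
    ultimately show ?thesis by linarith
  qed
  define T' where "T' = T2 - T"
  have T'_rep: "\<exists>i\<in>T. \<exists>j\<in>T. c = (i + j) mod d \<and> i \<noteq> 0 \<and> j \<noteq> 0" if c: "c \<in> T'" for c
  proof -
    obtain a b where ab: "a \<in> A" "b \<in> A" "c = (a + b) mod d"
      using c by (auto simp: T'_def T2_def elim!: set_plus_elim)
    then have "a mod d \<in> T" "b mod d \<in> T" "c = (a mod d + b mod d) mod d"
      by (auto simp: T_def mod_simps)
    moreover have "a mod d \<noteq> 0" "b mod d \<noteq> 0"
      using calculation c T T_mod unfolding T'_def by force+
    ultimately show ?thesis by blast
  qed
  \<comment> \<open>The trivial bound for a class outside \<open>T\<close>. As \<open>i\<close> and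
    \<open>j\<close> are nonzero, the holes of the zero class are not among theirs; the gain
    \<open>h 0\<close> is needed in the final sum.\<close>
  have D_low: "2 * int n - 2 * H + h 0 - 1 \<le> int (D c)" if c: "c \<in> T'" for c
  proof -
    obtain i j where ij: "i \<in> T" "j \<in> T" "c = (i + j) mod d" "i \<noteq> 0" "j \<noteq> 0"
      using T'_rep[OF c] by blast
    have "int n - h i + (int n - h j) \<le> int (D c) + 1"
      using D_trivial[OF ij(1,2)] unfolding ij(3) h_def by simp
    moreover have "h i + h j \<le> 2 * H - h 0"
    proof (cases "i = j")
      case True
      then show ?thesis using subset_h[of "{0, i}"] h0[OF T(6)] ij T(6) by simp
    next
      case False
      then show ?thesis using subset_h[of "{0, i, j}"] H0 ij T(6) by simp
    qed
    ultimately show ?thesis by linarith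
  qed
  have D_sparse: "\<exists>i\<in>T. c = (i + i) mod d \<and> 2 * \<alpha> i \<le> n" if c: "c \<in> T'" "D c < n" for c
  proof -
    obtain i j where ij: "i \<in> T" "j \<in> T" "c = (i + j) mod d"
      using T'_rep[OF c(1)] by blast
    then have "\<not> n < \<alpha> i + \<alpha> j" using D_full[of i j] c(2) by auto
    moreover from this have "i = j" using pair ij by blast
    ultimately show ?thesis using ij by auto
  qed
  have finT': "finite T'" using T by (simp add: T'_def)
  have cardT': "card T' = card T2 - s"
    unfolding T'_def s_def using T by (intro card_Diff_subset) auto
  then have "T' \<noteq> {}" using cardT2 s2 by auto
  \<comment> \<open>At most one class of \<open>T'\<close> receives fewer than \<open>n\<close>
    sums: two such classes would be doubles of distinct \<open>i\<close>, \<open>j\<close> with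
    \<open>\<alpha> i + \<alpha> j \<le> n\<close>, against \<open>pair\<close>. If there is none,
    any class serves as \<open>e\<close>.\<close>
  obtain e where e: "e \<in> T'" "\<And>c. c \<in> T' - {e} \<Longrightarrow> n \<le> D c"
  proof (cases "\<forall>c\<in>T'. n \<le> D c")
    case True
    then show ?thesis using that \<open>T' \<noteq> {}\<close> by auto
  next
    case False
    then obtain e where e: "e \<in> T'" "D e < n" by auto
    have "n \<le> D c" if c: "c \<in> T'" "c \<noteq> e" for c
    proof (rule ccontr)
      assume "\<not> n \<le> D c"
      then obtain i j where "i \<in> T" "e = (i + i) mod d" "2 * \<alpha> i \<le> n"
          "j \<in> T" "c = (j + j) mod d" "2 * \<alpha> j \<le> n"
        using D_sparse[OF e] D_sparse[OF c(1)] by auto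
      then show False using c(2) pair[of i j] by fastforce
    qed
    then show ?thesis using that e by auto
  qed

  \<comment> \<open>Summation over the classes\<close>
  have "card (A + A) = (\<Sum>c\<in>T2. D c)"
    unfolding D_def using finAA T by (intro card_eq_sum_fibres) (auto simp: T2_def)
  also have "\<dots> = (\<Sum>c\<in>T. D c) + (\<Sum>c\<in>T'. D c)"
    unfolding T'_def using T by (metis add.commute sum.subset_diff)
  also have "(\<Sum>c\<in>T. D c) = D 0 + (\<Sum>c\<in>T - {0}. D c)" using T by (intro sum.remove)
  also have "(\<Sum>c\<in>T'. D c) = D e + (\<Sum>c\<in>T' - {e}. D c)" using finT' e by (intro sum.remove)
  finally have cardAA: "card (A + A) = D 0 + (\<Sum>c\<in>T - {0}. D c) + (D e + (\<Sum>c\<in>T' - {e}. D c))" .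
  have s1: "(\<Sum>c\<in>T - {0}. n + \<alpha> c) \<le> (\<Sum>c\<in>T - {0}. D c)" using DT by (intro sum_mono) auto
  have "(\<Sum>c\<in>T - {0}. n + \<alpha> c) = (s - 1) * n + (\<Sum>c\<in>T - {0}. \<alpha> c)"
    using T by (simp add: sum.distrib s_def)
  moreover have "card A' = \<alpha> 0 + (\<Sum>c\<in>T - {0}. \<alpha> c)"
    unfolding sum_\<alpha>[symmetric] using T by (intro sum.remove)
  ultimately have s1': "(s - 1) * n + card A' \<le> \<alpha> 0 + (\<Sum>c\<in>T - {0}. D c)" using s1 by linarith
  \<comment> \<open>By \<open>cardT2\<close>, \<open>T'\<close> has at least \<open>s - 1\<close>
    classes, one of which is \<open>e\<close>.\<close>
  have "(s - 2) * n \<le> (card T' - 1) * n" using cardT' cardT2 s2 by (intro mult_right_mono) auto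
  also have "\<dots> = (\<Sum>c\<in>T' - {e}. n)" using finT' e by simp
  also have "\<dots> \<le> (\<Sum>c\<in>T' - {e}. D c)" using e by (intro sum_mono) auto
  finally have s3: "(s - 2) * n \<le> (\<Sum>c\<in>T' - {e}. D c)" .
  obtain t where "s = t + 2" using s2 by (metis add.commute le_Suc_ex)
  then have mult1: "s * n = (s - 1) * n + n" and mult2: "s * n = (s - 2) * n + 2 * n"
    by (simp_all add: algebra_simps)
  define p where "p = int s * int n"
  have s1'': "p - int n + int (card A') \<le> int (\<alpha> 0) + int (\<Sum>c\<in>T - {0}. D c)"
    using s1' mult1 unfolding p_def of_nat_mult[symmetric] by linarith
  have s3': "p - 2 * int n \<le> int (\<Sum>c\<in>T' - {e}. D c)"
    using s3 mult2 unfolding p_def of_nat_mult[symmetric] by linarith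
  \<comment> \<open>The four bounds add up to \<open>2 * p + card A' - 2 * H\<close>, which is
    \<open>3 * card A'\<close>; the terms in \<open>\<alpha> 0\<close> cancel against
    \<open>h 0\<close>.\<close>
  have "int (card (A + A)) = int (D 0) + int (\<Sum>c\<in>T - {0}. D c) + (int (D e) + int (\<Sum>c\<in>T' - {e}. D c))"
    unfolding cardAA by simp
  moreover have "2 * int (\<alpha> 0) + 1 \<le> int (D 0)" using D0 by linarith
  moreover have "H = p - int (card A')" using H p_def by simp
  moreover have "h 0 = int n - int (\<alpha> 0)" by (simp add: h_def)
  ultimately have "3 * int (card A') \<le> int (card (A + A))"
    using D_low[OF e(1)] s1'' s3' by linarith
  then show ?thesis using cardA' unfolding k_def by linarith
qed

section \<open>Pairs of sets\<close>

lemma card_window_le_residues: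
  fixes A :: "int set"
  assumes "finite A" "m > 0" "y \<le> x + m"
  shows "card (A \<inter> {x..<y}) \<le> card ((\<lambda>z. z mod m) ` A)"
proof (rule card_inj_on_le)
  show "inj_on (\<lambda>z. z mod m) (A \<inter> {x..<y})"
  proof (rule inj_onI)
    fix z z' assume *: "z \<in> A \<inter> {x..<y}" "z' \<in> A \<inter> {x..<y}" "z mod m = z' mod m"
    then have "m dvd z - z'" by (simp add: mod_eq_dvd_iff)
    moreover have "\<bar>z - z'\<bar> < m" using * assms(3) by auto
    ultimately show "z = z'" using dvd_imp_le_int[of "z - z'" m] by fastforce
  qed
qed (use assms in auto)

lemma card_window_le_length:
  fixes A :: "int set"
  assumes "x \<le> y"
  shows "int (card (A \<inter> {x..<y})) \<le> y - x"
  using card_mono[of "{x..<y}" "A \<inter> {x..<y}"] assms by simp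

text \<open>Let \<open>x\<close> be the last element of the class of \<open>u\<close> missing from \<open>A + A\<close>, so that the next one
  is missing from \<open>A + A - N\<close>. Then \<open>A\<close> has density at most one half before \<open>x\<close> and after \<open>x + m\<close>.\<close>

lemma card_le_if_class_not_doubly_covered:
  fixes A :: "int set"
  assumes A: "A \<subseteq> {0..N}" and u: "0 \<le> u" "u < m" "m \<le> N" "u \<notin> (\<lambda>z. z mod m) ` A"
    and single: "\<And>x. 0 \<le> x \<Longrightarrow> x \<le> N \<Longrightarrow> x mod m = u \<Longrightarrow> x \<notin> A + A \<or> x + N \<notin> A + A"
  shows "2 * int (card A) \<le> N + 1 + int (card ((\<lambda>z. z mod m) ` A))"
proof -
  define w where "w = card ((\<lambda>z. z mod m) ` A)"
  have finA: "finite A" using A finite_subset by blast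
  have m: "m > 0" using u by simp
  have "(\<lambda>z. z mod m) ` A \<subseteq> {0..<m} - {u}" using m u by auto
  then have "w \<le> card ({0..<m} - {u})" unfolding w_def by (intro card_mono) auto
  \<comment> \<open>The class of \<open>u\<close> is missed, hence one less than \<open>m\<close>;
    this makes up for the two roundings in the half-density bounds below.\<close>
  then have wm: "int w + 1 \<le> m" using u by auto
  have split3: "card A \<le> card (A \<inter> X) + card (A \<inter> Y) + card (A \<inter> Z)" if "{0..N} \<subseteq> X \<union> Y \<union> Z" for X Y Z
  proof -
    have "card A \<le> card ((A \<inter> X) \<union> (A \<inter> Y) \<union> (A \<inter> Z))"
      using that A finA by (intro card_mono) auto
    then show ?thesis
      using card_Un_le[of "(A \<inter> X) \<union> (A \<inter> Y)" "A \<inter> Z"] card_Un_le[of "A \<inter> X" "A \<inter> Y"] by linarith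
  qed
  define L where "L = {x \<in> {0..N}. x mod m = u \<and> x \<notin> A + A}"
  have finL: "finite L" by (rule finite_subset[of _ "{0..N}"]) (auto simp: L_def)
  show ?thesis
  proof (cases "L = {}")
    case True
    \<comment> \<open>Here \<open>u\<close> itself is a sum, so \<open>u + N\<close> is not. The
      part of \<open>A\<close> below \<open>u\<close> is counted once by its length and once by
      \<open>w\<close>.\<close>
    have "u \<in> {0..N}" "u mod m = u" using u by auto
    then have "u + N \<notin> A + A" using True single[of u] by (auto simp: L_def)
    then have "2 * int (card (A \<inter> {u..N})) \<le> N - u + 1"
      using A u by (intro card_above_non_sum) auto
    moreover have "card A \<le> card (A \<inter> {0..<u}) + card (A \<inter> {u..N}) + card (A \<inter> {})"
      using u by (intro split3) auto
    moreover have "int (card (A \<inter> {0..<u})) \<le> u" "card (A \<inter> {0..<u}) \<le> w"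
      using u card_window_le_length[of 0 u A] card_window_le_residues[OF finA m, of u 0]
      by (auto simp: w_def)
    ultimately show ?thesis unfolding w_def[symmetric] by simp
  next
    case False
    define x where "x = Max L"
    have x: "x \<in> L" "\<And>y. y \<in> L \<Longrightarrow> y \<le> x" using finL False by (auto simp: x_def)
    then have below: "2 * int (card (A \<inter> {0..x})) \<le> x + 1"
      using A by (intro card_below_non_sum) (auto simp: L_def)
    show ?thesis
    proof (cases "x + m \<le> N")
      case True
      have xm: "0 \<le> x + m" "(x + m) mod m = u" using x(1) m by (auto simp: L_def)
      have "x + m \<notin> L" using x(2)[of "x + m"] m by auto
      then have "x + m \<in> A + A" using True xm by (auto simp: L_def)
      then have "x + m + N \<notin> A + A" using single[of "x + m"] True xm by auto
      then have "2 * int (card (A \<inter> {x + m..N})) \<le> N - (x + m) + 1"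
        using A True by (intro card_above_non_sum) auto
      moreover have "card A \<le> card (A \<inter> {0..x}) + card (A \<inter> {x + 1..<x + m}) + card (A \<inter> {x + m..N})"
        by (intro split3) auto
      \<comment> \<open>The gap between the two sparse parts is shorter than \<open>m\<close>, and
        \<open>2 * w \<le> w + m - 1\<close>.\<close>
      moreover have "card (A \<inter> {x + 1..<x + m}) \<le> w"
        using card_window_le_residues[OF finA m] by (auto simp: w_def)
      ultimately show ?thesis using below wm unfolding w_def[symmetric] by linarith
    next
      case False
      \<comment> \<open>Mirror image of the first case: the part above \<open>x\<close> is counted
        once by its length and once by \<open>w\<close>.\<close>
      have "card A \<le> card (A \<inter> {0..x}) + card (A \<inter> {x + 1..<N + 1}) + card (A \<inter> {})"
        by (intro split3) auto
      moreover have "int (card (A \<inter> {x + 1..<N + 1})) \<le> N - x" "card (A \<inter> {x + 1..<N + 1}) \<le> w"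
        using x(1) False card_window_le_length[of "x + 1" "N + 1" A]
          card_window_le_residues[OF finA m, of "N + 1" "x + 1"]
        by (auto simp: w_def L_def)
      ultimately show ?thesis using below unfolding w_def[symmetric] by simp
    qed
  qed
qed

text \<open>The claim says that the holes of \<open>A\<close> and \<open>B\<close> in their hulls
  number at most \<open>b\<close>, the total excess. By \<open>lenA\<close> the excess of
  \<open>A + A\<close> pays for the holes of \<open>A\<close> and for \<open>E\<close>. The holes of
  \<open>B\<close> are paid by \<open>B + B\<close>, or by \<open>A + B\<close> and
  \<open>E\<close>.\<close>

lemma lengths_le_normal_form:
  fixes A B :: "int set"
  assumes A: "A \<subseteq> {0..N}" "0 \<in> A" "N \<in> A" "N > 0" and gcd: "\<And>d. (\<And>a. a \<in> A \<Longrightarrow> d dvd a) \<Longrightarrow> is_unit d"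
    and B: "B \<subseteq> {0..m}" "0 \<in> B" "m \<in> B" and le: "card B \<le> card A"
    and k: "k = card A + card B" "3 * b + 6 < k"
    and card: "card (A + A) + card (A + B) + card (B + B) + 3 = 3 * k + b"
  shows "N + m + 2 \<le> int k + int b"
proof -
  have fin: "finite A" "finite B" using A B finite_subset by blast+
  have ne: "A \<noteq> {}" "B \<noteq> {}" using A B by auto
  have triv: "2 * card A \<le> card (A + A) + 1" "card A + card B \<le> card (A + B) + 1"
    "2 * card B \<le> card (B + B) + 1"
    using card_sumset_ge[OF fin(1,1) ne(1,1)] card_sumset_ge[OF fin ne]
      card_sumset_ge[OF fin(2,2) ne(2,2)] by simp_all
  \<comment> \<open>Otherwise the excess of \<open>A + A\<close> is at least
    \<open>card A - 2 \<ge> k / 2 - 2 > b\<close>.\<close>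
  have NA: "N \<le> 2 * int (card A) - 3"
  proof (rule ccontr)
    assume "\<not> ?thesis"
    then have "3 * card A \<le> card (A + A) + 3" using A gcd by (intro card_sumset_ge_3k_minus_3) auto
    then show False using triv card k le by linarith
  qed
  define E where "E = {x \<in> {0..N} - A. x \<in> A + A \<and> x + N \<in> A + A}"
  have finE: "finite E" by (rule finite_subset[of _ "{0..N}"]) (auto simp: E_def)
  have lenA: "N + int (card A) + int (card E) \<le> int (card (A + A))"
    unfolding E_def using A(1-3) NA by (rule card_sumset_ge_length)
  show ?thesis
  proof (cases "k \<le> 3 * card B")
    case True
    \<comment> \<open>Otherwise the excess of \<open>A + B\<close> is at least
      \<open>card B - 1 \<ge> k / 3 - 1 > b\<close>. So \<open>B\<close> inherits gcd 1 from
      \<open>A\<close>.\<close>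
    have dvdA: "d dvd x" if d: "\<And>y. y \<in> B \<Longrightarrow> d dvd y" and x: "x \<in> A" for d x
    proof (rule ccontr)
      assume "\<not> d dvd x"
      then have "2 * card B + card A \<le> card (B + A) + 2"
        using d x A(2) fin ne by (intro card_sumset_two_classes[of _ _ d x 0]) auto
      then show False using triv card k True by (simp add: add.commute)
    qed
    have gcdB: "is_unit d" if "\<And>y. y \<in> B \<Longrightarrow> d dvd y" for d
      using gcd dvdA that by blast
    have "m \<noteq> 0"
    proof
      assume "m = 0"
      then have "B = {0}" using B by auto
      then show False using True k by simp
    qed
    then have m: "m > 0" using B by force
    have "m \<le> 2 * int (card B) - 3"
    proof (rule ccontr)
      assume "\<not> ?thesis"
      then have "3 * card B \<le> card (B + B) + 3"
        using B gcdB m by (intro card_sumset_ge_3k_minus_3) auto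
      then show False using triv card k True by linarith
    qed
    then have "m + int (card B) \<le> int (card (B + B))"
      using card_sumset_ge_length[OF B] by linarith
    then show ?thesis using lenA triv card k by linarith
  next
    case False
    show ?thesis
    proof (cases "m = 0")
      case True
      then have "B = {0}" using B by auto
      then show ?thesis using True lenA triv card k by simp
    next
      case False
      then have m: "m > 0" using B by force
      define C where "C = (\<lambda>x. x mod m) ` (A + B)"
      have AB: "card A + card C \<le> card (A + B)"
        unfolding C_def using fin B m by (intro card_sumset_ge_residues)
      have AC: "(\<lambda>x. x mod m) ` A \<subseteq> C"
        unfolding C_def by (intro image_mono subset_sumset_zero B)
      have C: "C \<subseteq> {0..<m}" "finite C" using m fin by (auto simp: C_def finite_set_plus)
      \<comment> \<open>The total excess would be at least
        \<open>card A - card B + 1 = k - 2 * card B + 1\<close>, which exceeds \<open>b\<close>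
        because \<open>3 * card B < k\<close>.\<close>
      have contra: False if "4 * int (card A) + 2 * int (card B) - 2 \<le> int (card (A + A)) + int (card (A + B)) + int (card (B + B))"
        using that card k \<open>\<not> k \<le> 3 * card B\<close> by linarith
      have cardC: "card ((\<lambda>x. x mod m) ` A) \<le> card C" using AC C(2) by (rule card_mono[rotated])
      show ?thesis
      proof (cases "m \<le> N")
        case False
        \<comment> \<open>For \<open>N < m\<close> the elements of \<open>A\<close> are distinct
          modulo \<open>m\<close>, so \<open>A + B\<close> has at least \<open>2 * card A\<close>
          elements.\<close>
        have "card (A \<inter> {0..<N + 1}) \<le> card ((\<lambda>x. x mod m) ` A)"
          using False fin m by (intro card_window_le_residues) auto
        moreover have "A \<inter> {0..<N + 1} = A" using A by auto
        ultimately have "2 * card A \<le> card (A + B)" using AB cardC by simp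
        then have False using triv by (intro contra) linarith
        then show ?thesis ..
      next
        case True
        show ?thesis
        proof (cases "{0..<m} - C \<subseteq> (\<lambda>x. x mod m) ` E")
          case True
          \<comment> \<open>Each class missed by \<open>A + B\<close> is charged to an element of
            \<open>E\<close>, so \<open>m \<le> card E + card C\<close>.\<close>
          then have "card ({0..<m} - C) \<le> card E" using finE by (metis surj_card_le)
          moreover have "card ({0..<m} - C) = card {0..<m} - card C"
            using C by (intro card_Diff_subset) auto
          moreover have "card C \<le> card {0..<m}" using C by (intro card_mono) auto
          ultimately have "m \<le> int (card E) + int (card C)" using m by simp
          then show ?thesis using lenA AB triv card k by linarith
        next
          case False
          then obtain u where "u \<in> {0..<m} - C" "u \<notin> (\<lambda>x. x mod m) ` E" by blast
          then have u: "0 \<le> u" "u < m" "u \<notin> C" "u \<notin> (\<lambda>x. x mod m) ` E" by simp_all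
          have uA: "u \<notin> (\<lambda>x. x mod m) ` A" using u AC by auto
          \<comment> \<open>The class of \<open>u\<close> avoids both \<open>A\<close> and
            \<open>E\<close>, so none of its elements is doubly covered. With \<open>lenA\<close>
            and \<open>AB\<close> the resulting bound yields exactly the total in
            \<open>contra\<close>.\<close>
          have "2 * int (card A) \<le> N + 1 + int (card ((\<lambda>z. z mod m) ` A))"
            using A(1) u(1,2) True uA
          proof (rule card_le_if_class_not_doubly_covered)
            fix x assume "0 \<le> x" "x \<le> N" "x mod m = u"
            then show "x \<notin> A + A \<or> x + N \<notin> A + A" using u(4) uA by (auto simp: E_def)
          qed
          then have False using lenA AB cardC triv by (intro contra) linarith
          then show ?thesis ..
        qed
      qed
    qed
  qed
qed

section \<open>Rescaling to normal form\<close>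

lemma card_sumset_affine:
  fixes A B :: "int set"
  assumes "g \<noteq> 0"
  shows "card ((\<lambda>x. p + g * x) ` A + (\<lambda>x. q + g * x) ` B) = card (A + B)"
proof -
  have "(\<lambda>x. p + g * x) ` A + (\<lambda>x. q + g * x) ` B = (\<lambda>x. (p + q) + g * x) ` (A + B)"
  proof (intro equalityI subsetI)
    fix z assume "z \<in> (\<lambda>x. p + g * x) ` A + (\<lambda>x. q + g * x) ` B"
    then obtain a b where "a \<in> A" "b \<in> B" "z = (p + g * a) + (q + g * b)" by (auto elim!: set_plus_elim)
    then show "z \<in> (\<lambda>x. (p + q) + g * x) ` (A + B)"
      by (intro image_eqI[of _ _ "a + b"]) (auto simp: algebra_simps)
  next
    fix z assume "z \<in> (\<lambda>x. (p + q) + g * x) ` (A + B)"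
    then obtain a b where "a \<in> A" "b \<in> B" "z = (p + q) + g * (a + b)" by (auto elim!: set_plus_elim)
    then show "z \<in> (\<lambda>x. p + g * x) ` A + (\<lambda>x. q + g * x) ` B"
      by (intro sumsetI[of "p + g * a" _ "q + g * b"]) (auto simp: algebra_simps)
  qed
  moreover have "inj_on (\<lambda>x. (p + q) + g * x) (A + B)" using assms by (auto simp: inj_on_def)
  ultimately show ?thesis by (simp add: card_image)
qed

lemma common_class_affine_image:
  fixes Q :: "int set"
  assumes "finite Q" "Q \<noteq> {}" "g > 0" and dvd: "\<And>x. x \<in> Q \<Longrightarrow> g dvd x - Min Q"
  obtains B m where "Q = (\<lambda>x. Min Q + g * x) ` B" "B \<subseteq> {0..m}" "0 \<in> B" "m \<in> B"
proof
  let ?f = "\<lambda>x. (x - Min Q) div g"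
  have "Min Q + g * ?f x = x" if "x \<in> Q" for x using dvd[OF that] by simp
  then show "Q = (\<lambda>x. Min Q + g * x) ` ?f ` Q" by (auto simp: image_image)
  show "?f ` Q \<subseteq> {0..?f (Max Q)}"
    using assms by (auto simp: pos_imp_zdiv_nonneg_iff zdiv_mono1)
  show "0 \<in> ?f ` Q" using assms by (intro image_eqI[of _ _ "Min Q"]) auto
  show "?f (Max Q) \<in> ?f ` Q" using assms by auto
qed

text \<open>Dividing by the gcd \<open>g\<close> of the differences of \<open>P\<close> gives the
  normal form. The last conclusion later makes \<open>g\<close> a multiple of the original
  difference.\<close>

lemma lengths_le_if_card_le:
  fixes P Q :: "int set"
  assumes fin: "finite P" "finite Q" "Q \<noteq> {}" and le: "card Q \<le> card P"
    and k: "k = card P + card Q" "3 * b + 6 < k"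
    and card: "card (P + P) + card (P + Q) + card (Q + Q) + 3 = 3 * k + b"
  obtains g p A N q B m where "g > 0"
    "P = (\<lambda>x. p + g * x) ` A" "A \<subseteq> {0..N}" "0 \<in> A" "N \<in> A"
    "Q = (\<lambda>x. q + g * x) ` B" "B \<subseteq> {0..m}" "0 \<in> B" "m \<in> B"
    "N + m + 2 \<le> int k + int b"
    "\<forall>d. (\<forall>x\<in>P. \<forall>y\<in>P. d dvd x - y) \<longrightarrow> d dvd g"
proof -
  have neP: "P \<noteq> {}" using le k by auto
  define p where "p = Min P"
  define g where "g = Gcd ((\<lambda>x. x - p) ` P)"
  have p: "p \<in> P" using fin neP by (simp add: p_def)
  have gdvd: "g dvd x - p" if "x \<in> P" for x unfolding g_def using that by (intro Gcd_dvd) auto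
  have gmax: "d dvd g" if "\<And>x. x \<in> P \<Longrightarrow> d dvd x - p" for d
    unfolding g_def using that by (intro Gcd_greatest) auto
  have "g \<noteq> 0"
  proof
    assume "g = 0"
    then have "P \<subseteq> {p}" using gdvd by fastforce
    then have "card P \<le> 1" using card_mono[of "{p}" P] by simp
    then show False using le k by linarith
  qed
  moreover have "g \<ge> 0" by (simp add: g_def)
  ultimately have g: "g > 0" by simp
  obtain A N where A: "P = (\<lambda>x. p + g * x) ` A" "A \<subseteq> {0..N}" "0 \<in> A" "N \<in> A"
    using common_class_affine_image[OF fin(1) neP g] gdvd unfolding p_def by metis
  have Pdvd: "g dvd x - y" if "x \<in> P" "y \<in> P" for x y
    using dvd_diff[OF gdvd[OF that(1)] gdvd[OF that(2)]] by simp
  have trivial: "2 * card P \<le> card (P + P) + 1" "2 * card Q \<le> card (Q + Q) + 1"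
    using card_sumset_ge[OF fin(1,1) neP neP] card_sumset_ge[OF fin(2,2,3,3)] by simp_all
  \<comment> \<open>If \<open>Q\<close> met two classes modulo \<open>g\<close>, the excess of
    \<open>P + Q\<close> would be at least \<open>card P - 1 \<ge> k / 2 - 1 > b\<close>.\<close>
  have "g dvd x - Min Q" if "x \<in> Q" for x
  proof (rule ccontr)
    assume "\<not> ?thesis"
    then have "2 * card P + card Q \<le> card (P + Q) + 2"
      using that fin neP Pdvd by (intro card_sumset_two_classes[of _ _ g x "Min Q"]) auto
    then show False using trivial card k le by linarith
  qed
  then obtain B m where B: "Q = (\<lambda>x. Min Q + g * x) ` B" "B \<subseteq> {0..m}" "0 \<in> B" "m \<in> B"
    using common_class_affine_image[OF fin(2,3) g] by metis
  define q where "q = Min Q"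
  have B': "Q = (\<lambda>x. q + g * x) ` B" using B(1) by (simp add: q_def)
  have inj: "inj_on (\<lambda>x. c + g * x) X" for c X using g by (auto simp: inj_on_def)
  have cardAB: "card P = card A" "card Q = card B" by (simp_all add: A(1) B' card_image[OF inj])
  have sums: "card (P + P) = card (A + A)" "card (P + Q) = card (A + B)" "card (Q + Q) = card (B + B)"
    unfolding A(1) B' using g by (auto intro: card_sumset_affine)
  have unit: "is_unit d" if d: "\<And>a. a \<in> A \<Longrightarrow> d dvd a" for d
  proof -
    have "g * d dvd x - p" if "x \<in> P" for x using that d by (auto simp: A(1))
    then have "g * d dvd g * 1" using gmax by simp
    then show ?thesis using g by (simp only: dvd_mult_cancel_left) simp
  qed
  have "N \<noteq> 0"
  proof
    assume "N = 0"
    then have "A = {0}" using A by auto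
    then show False using cardAB le k by simp
  qed
  then have "N > 0" using A by force
  have "N + m + 2 \<le> int k + int b"
  proof (rule lengths_le_normal_form[OF A(2-4) \<open>N > 0\<close> unit B(2-4)])
    show "card B \<le> card A" "k = card A + card B" "3 * b + 6 < k"
      "card (A + A) + card (A + B) + card (B + B) + 3 = 3 * k + b"
      using le k card cardAB sums by simp_all
  qed
  moreover have "\<forall>d. (\<forall>x\<in>P. \<forall>y\<in>P. d dvd x - y) \<longrightarrow> d dvd g"
    using gmax p by blast
  ultimately show ?thesis by (rule that[OF g A B' B(2-4)])
qed

section \<open>Bi-arithmetic progressions\<close>

text \<open>The larger set determines \<open>g\<close>. Divisibility is therefore required on both
  sets, which makes the statement symmetric in \<open>P\<close> and \<open>Q\<close>.\<close>

lemma lengths_le: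
  fixes P Q :: "int set"
  assumes fin: "finite P" "finite Q" "P \<noteq> {}" "Q \<noteq> {}"
    and k: "k = card P + card Q" "3 * b + 6 < k"
    and card: "card (P + P) + card (P + Q) + card (Q + Q) + 3 = 3 * k + b"
  obtains g p A N q B m where "g > 0"
    "P = (\<lambda>x. p + g * x) ` A" "A \<subseteq> {0..N}" "0 \<in> A" "N \<in> A"
    "Q = (\<lambda>x. q + g * x) ` B" "B \<subseteq> {0..m}" "0 \<in> B" "m \<in> B"
    "N + m + 2 \<le> int k + int b"
    "\<forall>d. (\<forall>x\<in>P. \<forall>y\<in>P. d dvd x - y) \<and> (\<forall>x\<in>Q. \<forall>y\<in>Q. d dvd x - y) \<longrightarrow> d dvd g"
proof (cases "card Q \<le> card P")
  case True
  obtain g p A N q B m where *: "g > 0"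
    "P = (\<lambda>x. p + g * x) ` A" "A \<subseteq> {0..N}" "0 \<in> A" "N \<in> A"
    "Q = (\<lambda>x. q + g * x) ` B" "B \<subseteq> {0..m}" "0 \<in> B" "m \<in> B"
    "N + m + 2 \<le> int k + int b"
    "\<forall>d. (\<forall>x\<in>P. \<forall>y\<in>P. d dvd x - y) \<longrightarrow> d dvd g"
    using lengths_le_if_card_le[OF fin(1,2,4) True k card] .
  have "\<forall>d. (\<forall>x\<in>P. \<forall>y\<in>P. d dvd x - y) \<and> (\<forall>x\<in>Q. \<forall>y\<in>Q. d dvd x - y) \<longrightarrow> d dvd g"
    using *(11) by blast
  from that[OF *(1-10) this] show ?thesis .
next
  case False
  have le: "card P \<le> card Q" and k': "k = card Q + card P" using k False by simp_all
  have card': "card (Q + Q) + card (Q + P) + card (P + P) + 3 = 3 * k + b"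
    using card by (simp add: add.commute)
  obtain g q A N p B m where *: "g > 0"
    "Q = (\<lambda>x. q + g * x) ` A" "A \<subseteq> {0..N}" "0 \<in> A" "N \<in> A"
    "P = (\<lambda>x. p + g * x) ` B" "B \<subseteq> {0..m}" "0 \<in> B" "m \<in> B"
    "N + m + 2 \<le> int k + int b"
    "\<forall>d. (\<forall>x\<in>Q. \<forall>y\<in>Q. d dvd x - y) \<longrightarrow> d dvd g"
    using lengths_le_if_card_le[OF fin(2,1,3) le k' k(2) card'] .
  have "m + N + 2 \<le> int k + int b" using *(10) by linarith
  moreover have "\<forall>d. (\<forall>x\<in>P. \<forall>y\<in>P. d dvd x - y) \<and> (\<forall>x\<in>Q. \<forall>y\<in>Q. d dvd x - y) \<longrightarrow> d dvd g"
    using *(11) by blast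
  ultimately show ?thesis by (rule that[OF *(1,6-9,2-5)])
qed

section \<open>Transfer to natural numbers\<close>

lemma card_sumset_int: "card (int ` X + int ` Y) = card (X + Y)"
proof -
  have "int ` X + int ` Y = int ` (X + Y)"
    by (auto simp: set_plus_def image_iff) (metis of_nat_add)+
  then show ?thesis by (simp add: card_image)
qed

lemma arith_prog_between:
  assumes I: "arith_prog d l I" and x: "x \<in> I" "x + j * g \<in> I" and g: "d dvd g" and i: "i \<le> j"
  shows "x + i * g \<in> I"
proof -
  obtain a where a: "I = {a + i * d | i. i < l}" "d \<ge> 1" using I by (auto simp: arith_prog_def)
  obtain u v where u: "x = a + u * d" and v: "x + j * g = a + v * d" "v < l" using x a by auto
  obtain c where c: "g = d * c" using g by blast
  have "(u + j * c) * d = v * d" using u v c by (simp add: algebra_simps)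
  then have "u + j * c = v" using a(2) by simp
  moreover have "i * c \<le> j * c" using i by simp
  ultimately have "u + i * c < l" using v(2) by linarith
  moreover have "x + i * g = a + (u + i * c) * d" using u c by (simp add: algebra_simps)
  ultimately show ?thesis using a by blast
qed

text \<open>\<open>I'\<close> runs from the least to the greatest element of \<open>X\<close> with
  difference \<open>g\<close>. Its ends lie in \<open>I\<close> and \<open>d\<close> divides
  \<open>g\<close>, so it stays inside \<open>I\<close>.\<close>

lemma arith_prog_hull:
  fixes g p N :: int
  assumes I: "arith_prog d l I" and X: "X \<subseteq> I" "int ` X = (\<lambda>x. p + g * x) ` A"
    and A: "A \<subseteq> {0..N}" "0 \<in> A" "N \<in> A" and g: "g > 0" "int d dvd g"
  shows "\<exists>I'. arith_prog (nat g) (nat N + 1) I' \<and> X \<subseteq> I' \<and> I' \<subseteq> I \<and> int (card I') = N + 1"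
proof -
  have N: "N \<ge> 0" using A by auto
  have "p \<in> int ` X" unfolding X(2) using A(2) by (intro image_eqI[of _ _ 0]) auto
  then obtain x where x: "x \<in> X" "p = int x" by auto
  define G where "G = nat g"
  have G: "g = int G" "G \<ge> 1" using g by (auto simp: G_def)
  have X_mem: "\<exists>z\<in>A. y = x + nat z * G" if "y \<in> X" for y
  proof -
    have "int y \<in> (\<lambda>x. p + g * x) ` A" using that X(2) by blast
    then obtain z where z: "z \<in> A" "int y = p + g * z" by auto
    then have "int y = int (x + nat z * G)" using A(1) x G by auto
    then show ?thesis using z(1) by (metis of_nat_eq_iff)
  qed
  have "p + g * N \<in> int ` X" unfolding X(2) using A(3) by auto
  then obtain y where y: "y \<in> X" "int y = p + g * N" by auto
  then have "int y = int (x + nat N * G)" using x G N by simp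
  then have "x + nat N * G \<in> I" using y X(1) by (metis of_nat_eq_iff subsetD)
  moreover have "d dvd G" using g(2) G(1) by simp
  ultimately have between: "x + i * G \<in> I" if "i \<le> nat N" for i
    using arith_prog_between[OF I] x X(1) that by blast
  define I' where "I' = {x + i * G | i. i < nat N + 1}"
  have "I' = (\<lambda>i. x + i * G) ` {..<nat N + 1}" by (auto simp: I'_def)
  moreover have "inj_on (\<lambda>i. x + i * G) {..<nat N + 1}" using G by (auto simp: inj_on_def)
  ultimately have "card I' = nat N + 1" by (simp add: card_image)
  then have "int (card I') = N + 1" using N by simp
  moreover have "arith_prog G (nat N + 1) I'" using G unfolding arith_prog_def I'_def by auto
  moreover have "X \<subseteq> I'"
  proof
    fix y assume "y \<in> X"
    then obtain z where "z \<in> A" "y = x + nat z * G" using X_mem by blast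
    moreover from this have "nat z < nat N + 1" using A(1) nat_mono[of z N] by auto
    ultimately show "y \<in> I'" unfolding I'_def by blast
  qed
  moreover have "I' \<subseteq> I" using between by (auto simp: I'_def)
  ultimately show ?thesis unfolding G_def by blast
qed

lemma arith_prog_dvd_diff:
  assumes "arith_prog d l I" "x \<in> I" "y \<in> I"
  shows "int d dvd int x - int y"
proof -
  obtain a where "I = {a + i * d | i. i < l}" using assms(1) by (auto simp: arith_prog_def)
  then obtain u v where "x = a + u * d" "y = a + v * d" using assms by auto
  then have "int x - int y = int d * (int u - int v)" by (simp add: algebra_simps)
  then show ?thesis by simp
qed

theorem theorem1p3:
  fixes A I J :: "nat set" and d l k b :: nat
  assumes "finite A"
    and "bi_arith_prog d l I J"
    and "A \<subseteq> I \<union> J"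
    and "card A = k" and "k > 10"
    and "A \<inter> I \<noteq> {}" and "A \<inter> J \<noteq> {}"
    and "card (A + A) = 3 * k - 3 + b"
    and "real b < real k / 3 - 2"
  shows "\<exists>d' l' I' J'. bi_arith_prog d' l' I' J' \<and> A \<subseteq> I' \<union> J' \<and>
           A \<inter> I' \<noteq> {} \<and> A \<inter> J' \<noteq> {} \<and> card I' + card J' \<le> k + b"
proof -
  obtain l1 l2 where I: "arith_prog d l1 I" and J: "arith_prog d l2 J"
    and disj: "(I + I) \<inter> (I + J) = {}" "(I + I) \<inter> (J + J) = {}" "(I + J) \<inter> (J + J) = {}"
    using assms(2) by (auto simp: bi_arith_prog_def)
  define X where "X = A \<inter> I"
  define Y where "Y = A \<inter> J"
  have fin: "finite X" "finite Y" using assms(1) by (auto simp: X_def Y_def)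
  have A: "A = X \<union> Y" using assms(3) by (auto simp: X_def Y_def)
  have sub: "X + X \<subseteq> I + I" "X + Y \<subseteq> I + J" "Y + Y \<subseteq> J + J"
    by (intro sumset_mono; auto simp: X_def Y_def)+
  have "X \<inter> Y = {}"
  proof (rule ccontr)
    assume "X \<inter> Y \<noteq> {}"
    then obtain z where "z \<in> I" "z \<in> J" by (auto simp: X_def Y_def)
    then have "z + z \<in> (I + I) \<inter> (I + J)" by (simp add: set_plus_intro)
    then show False using disj(1) by simp
  qed
  then have cardA: "k = card X + card Y" using assms(4) fin by (simp add: A card_Un_disjoint)
  have "A + A = (X + X) \<union> (X + Y) \<union> (Y + Y)"
    unfolding A by (auto simp: set_plus_def) (metis add.commute)+
  moreover have "(X + X) \<inter> (X + Y) = {}" "((X + X) \<union> (X + Y)) \<inter> (Y + Y) = {}"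
    using sub disj by blast+
  ultimately have "card (A + A) = card (X + X) + card (X + Y) + card (Y + Y)"
    using fin by (simp add: card_Un_disjoint finite_set_plus)
  \<comment> \<open>The truncated \<open>3 * k - 3\<close> is exact because
    \<open>k > 10\<close>.\<close>
  then have card: "card (int ` X + int ` X) + card (int ` X + int ` Y) + card (int ` Y + int ` Y) + 3 = 3 * k + b"
    using assms(5,8) by (simp add: card_sumset_int)
  have "real (3 * b + 6) < real k" using assms(9) by simp
  then have bk: "3 * b + 6 < k" by linarith
  have ne: "X \<noteq> {}" "Y \<noteq> {}" using assms(6,7) by (auto simp: X_def Y_def)
  have k: "k = card (int ` X) + card (int ` Y)" by (simp add: cardA card_image)
  have finXY: "finite (int ` X)" "finite (int ` Y)" "int ` X \<noteq> {}" "int ` Y \<noteq> {}" using fin ne by simp_all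
  obtain g p B N q C m where *: "g > 0"
    "int ` X = (\<lambda>x. p + g * x) ` B" "B \<subseteq> {0..N}" "0 \<in> B" "N \<in> B"
    "int ` Y = (\<lambda>x. q + g * x) ` C" "C \<subseteq> {0..m}" "0 \<in> C" "m \<in> C"
    "N + m + 2 \<le> int k + int b"
    "\<forall>d. (\<forall>x\<in>int ` X. \<forall>y\<in>int ` X. d dvd x - y) \<and> (\<forall>x\<in>int ` Y. \<forall>y\<in>int ` Y. d dvd x - y) \<longrightarrow> d dvd g"
    using lengths_le[OF finXY k bk card] .
  have dg: "int d dvd g"
    using arith_prog_dvd_diff[OF I] arith_prog_dvd_diff[OF J]
    by (intro *(11)[rule_format] conjI ballI) (auto simp: X_def Y_def)
  have XY: "X \<subseteq> I" "Y \<subseteq> J" by (auto simp: X_def Y_def)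
  obtain I' where I': "arith_prog (nat g) (nat N + 1) I'" "X \<subseteq> I'" "I' \<subseteq> I" "int (card I') = N + 1"
    using arith_prog_hull[OF I XY(1) *(2-5) *(1) dg] by blast
  obtain J' where J': "arith_prog (nat g) (nat m + 1) J'" "Y \<subseteq> J'" "J' \<subseteq> J" "int (card J') = m + 1"
    using arith_prog_hull[OF J XY(2) *(6-9) *(1) dg] by blast
  \<comment> \<open>Shrinking \<open>I\<close> and \<open>J\<close> preserves the disjointness of
    the three sumsets.\<close>
  have "I' + I' \<subseteq> I + I" "I' + J' \<subseteq> I + J" "J' + J' \<subseteq> J + J"
    using I'(3) J'(3) by (simp_all add: sumset_mono)
  then have "bi_arith_prog (nat g) (card I' + card J') I' J'"
    unfolding bi_arith_prog_def using I'(1) J'(1) disj by blast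
  moreover have "A \<subseteq> I' \<union> J'" "A \<inter> I' \<noteq> {}" "A \<inter> J' \<noteq> {}"
    using I'(2) J'(2) A ne by auto
  moreover have "card I' + card J' \<le> k + b" using I'(4) J'(4) *(10) by linarith
  ultimately show ?thesis by blast
qed

end
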